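(* Let $p$ be a real number that is not an even integer (in particular $p\neq 0$). Then $$\int_0^1 \log\Gamma(x)\sin(p\pi x)\,dx = \frac{(1-\cos(p\pi))\,[\gamma+\log(2\pi)]}{2p\pi} + \frac{1-\cos(p\pi)}{4p\pi}\left[\psi\left(\frac{p}{2}\right)+\psi\left(-\frac{p}{2}\right)\right]$$ $$-\frac{2\sin(p\pi)\,[\gamma+\log(2\pi)]}{\pi^2}\left[\frac{1}{2p^2}-\frac{\pi}{4p}\cot\left(\frac{p\pi}{2}\right)\right]-\frac{2\sin(p\pi)}{\pi^2}\sum_{n=1}^{\infty}\frac{\log n}{4n^2-p^2}.$$
   Context: $\Gamma$ is the gamma function, $\psi=\Gamma'/\Gamma$ is the digamma function, $\gamma$ is Euler's constant, and $\log$ is the natural logarithm. *)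

theory Defs
  imports "HOL-Analysis.Analysis"
begin

end

theory Submission
  imports Defs
begin

text \<open>
  The formula is Parseval's identity on \<open>(0, 1)\<close> for \<open>ln \<Gamma>\<close> and the wave \<open>exp (\<i> \<pi> p x)\<close>, of which
  the imaginary part is taken. On one side stand Kummer's Fourier coefficients of \<open>ln \<Gamma>\<close>: the mean
  value is \<open>ln (2 \<pi>) / 2\<close>, and for \<open>n > 0\<close> the integral against \<open>exp (2 \<pi> \<i> n x)\<close> is
  \<open>1 / (4 n) + \<i> (\<gamma> + ln (2 \<pi> n)) / (2 \<pi> n)\<close>. On the other side stand the coefficients of the wave,
  which are proportional to \<open>1 / (2 n - p)\<close> for integers \<open>n\<close>. Adding the terms at \<open>n\<close> and \<open>- n\<close>, the
  parts \<open>1 / (4 n)\<close> give the partial fractions of \<open>\<psi>(p/2) + \<psi>(- p/2)\<close>, while the parts with \<open>ln n\<close>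
  give the series over \<open>ln n / (4 n\<^sup>2 - p\<^sup>2)\<close>. The remaining coefficients \<open>(\<gamma> + ln (2 \<pi>)) / (2 \<pi> n)\<close>
  are those of a linear function, and so the identity is applied to \<open>ln \<Gamma>(x) + (\<gamma> + ln (2 \<pi>)) x\<close>.

  Kummer's coefficients (\<open>has_integral_ln_Gamma_exp\<close>) are obtained from Gauss's product for \<open>\<Gamma>\<close>. With
  an exponential of period \<open>1\<close>, the integrals of \<open>ln (x + k)\<close> over \<open>[0, 1]\<close> assemble to one integral of
  \<open>ln y\<close> over \<open>[0, m + 1]\<close>, which is a value of the entire exponential integral \<open>Ein\<close> on the
  imaginary axis. Its growth there (\<open>Ein_imaginary_asymptotics\<close>) contains \<open>\<gamma>\<close> and the
  \<open>\<pi> / 2\<close> of the sine integral at once.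

  Parseval's identity (\<open>fourier_pairing_limit\<close>) follows from dominated convergence. The symmetric partial
  sums of the Fourier series of the wave, multiplied by \<open>exp (- \<i> \<pi> p x)\<close>, have an
  explicit multiple of the Dirichlet kernel as derivative. Hence they converge pointwise
  (\<open>wave_sum_diff_tendsto\<close>), with a bound that is logarithmic at the end points
  (\<open>wave_sum_variation\<close>). Since \<open>ln \<Gamma>\<close> is logarithmic at \<open>0\<close>, products of the two are dominated by
  squares of logarithms, and the series may be integrated term by term.
\<close>

section \<open>The exponential integral on the imaginary axis\<close>

text \<open>
  This is the entire exponential integral, the integral of \<open>(1 - exp (- t)) / t\<close> from \<open>0\<close> to \<open>z\<close>.
  The power series defines it on the whole plane at once; its coefficient for \<open>n = 0\<close> is \<open>0\<close>, being
  a division by \<open>0\<close>.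
\<close>
definition Ein :: "complex \<Rightarrow> complex" where
  "Ein z = (\<Sum>n. (- ((- 1) ^ n) / (of_nat n * fact n)) * z ^ n)"

lemma Ein_0 [simp]: "Ein 0 = 0"
  using powser_zero[of "\<lambda>n. - ((- 1) ^ n) / (of_nat n * fact n) :: complex"]
  by (simp add: Ein_def)

lemma summable_Ein: "summable (\<lambda>n. (- ((- 1) ^ n) / (of_nat n * fact n)) * (z::complex) ^ n)"
proof (rule summable_comparison_test')
  show "summable (\<lambda>n. norm z ^ n /\<^sub>R fact n)"
    by (rule summable_exp_generic)
  show "norm ((- ((- 1) ^ n) / (of_nat n * fact n)) * z ^ n) \<le> norm z ^ n /\<^sub>R fact n" if "n \<ge> 1" for n
    using that mult_right_mono[of 1 "real n" "norm z ^ n"]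
    by (simp add: norm_mult norm_divide norm_power field_simps)
qed

lemma has_field_derivative_Ein:
  "(Ein has_field_derivative (if z = 0 then 1 else (1 - exp (- z)) / z)) (at z)"
proof -
  let ?c = "\<lambda>n. - ((- 1) ^ n) / (of_nat n * fact n) :: complex"
  have d: "(Ein has_field_derivative (\<Sum>n. diffs ?c n * z ^ n)) (at z)"
    unfolding Ein_def [abs_def] by (rule termdiffs_strong_converges_everywhere) (rule summable_Ein)
  have "(\<Sum>n. diffs ?c n * z ^ n) = (if z = 0 then 1 else (1 - exp (- z)) / z)"
  proof (cases "z = 0")
    case True
    have "(\<Sum>n. diffs ?c n * 0 ^ n) = diffs ?c 0"
      by (rule powser_zero)
    then show ?thesis using True by (simp add: diffs_def)
  next
    case False
    have "(\<lambda>n. (- z) ^ n /\<^sub>R fact n) sums exp (- z)"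
      by (rule exp_converges)
    then have "(\<lambda>n. (- z) ^ Suc n /\<^sub>R fact (Suc n)) sums (exp (- z) - 1)"
      by (subst sums_Suc_iff) simp
    then have s: "(\<lambda>n. (- 1 / z) * ((- z) ^ Suc n /\<^sub>R fact (Suc n))) sums ((- 1 / z) * (exp (- z) - 1))"
      by (rule sums_mult)
    have e: "(- 1 / z) * ((- z) ^ Suc n /\<^sub>R fact (Suc n)) = diffs ?c n * z ^ n" for n
      using False
      by (simp add: diffs_def scaleR_conv_of_real field_simps power_minus[of z] del: of_nat_Suc)
    from s have "(\<lambda>n. diffs ?c n * z ^ n) sums ((- 1 / z) * (exp (- z) - 1))"
      unfolding e .
    then show ?thesis
      using False by (simp add: sums_iff field_simps)
  qed
  with d show ?thesis by simp
qed

lemma continuous_on_Ein [continuous_intros]: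
  "continuous_on S f \<Longrightarrow> continuous_on S (\<lambda>x. Ein (f x))"
  by (rule continuous_on_compose2[of UNIV Ein])
     (auto intro!: continuous_at_imp_continuous_on DERIV_isCont has_field_derivative_Ein)

text \<open>
  Both bounds come from \<open>1 + t \<le> exp t\<close>. For the second one, multiply by \<open>exp u \<ge> (1 + u / n) ^ n\<close>
  and apply Bernoulli's inequality to \<open>(1 - (u / n)\<^sup>2) ^ n\<close>.
\<close>
lemma exp_minus_power_approx:
  fixes u :: real
  assumes n: "n > 0" and u: "0 \<le> u" "u \<le> real n"
  shows "(1 - u / n) ^ n \<le> exp (- u)" "exp (- u) - (1 - u / n) ^ n \<le> u\<^sup>2 * exp (- u) / n"
proof -
  have pos: "0 \<le> 1 - u / n" using u n by (simp add: field_simps)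
  have e: "exp (u / n) ^ n = exp u" "exp (- (u / n)) ^ n = exp (- u)"
    using n by (simp_all flip: exp_of_nat_mult)
  have "1 - u / n \<le> exp (- (u / n))" using exp_ge_add_one_self[of "- (u / n)"] by simp
  from power_mono[OF this pos, of n] show "(1 - u / n) ^ n \<le> exp (- u)" by (simp add: e)
  have "u\<^sup>2 \<le> (real n)\<^sup>2"
    using u by (intro power_mono) auto
  then have "-1 \<le> - (u / n)\<^sup>2" using n by (simp add: field_simps power_divide)
  from Bernoulli_inequality[OF this, of n]
  have "1 - u\<^sup>2 / n \<le> (1 - (u / n)\<^sup>2) ^ n"
    using n by (simp add: power2_eq_square)
  also have "\<dots> = (1 - u / n) ^ n * (1 + u / n) ^ n"
    by (simp add: power2_eq_square algebra_simps flip: power_mult_distrib)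
  also have "\<dots> \<le> (1 - u / n) ^ n * exp (u / n) ^ n"
    using pos u n by (intro mult_left_mono power_mono exp_ge_add_one_self) auto
  finally have "(1 - u\<^sup>2 / n) * exp (- u) \<le> (1 - u / n) ^ n * exp u * exp (- u)"
    by (simp add: e)
  also have "\<dots> = (1 - u / n) ^ n" by (simp add: mult.assoc flip: exp_add)
  finally show "exp (- u) - (1 - u / n) ^ n \<le> u\<^sup>2 * exp (- u) / n"
    by (simp add: algebra_simps)
qed

text \<open>
  The harmonic number is the integral of \<open>(1 - (1 - u / n) ^ n) / u\<close> over \<open>[0, n]\<close>, the integral
  defining \<open>Ein n\<close> with \<open>exp (- u)\<close> replaced by \<open>(1 - u / n) ^ n\<close>. This is where Euler's constant
  enters.
\<close>
lemma norm_Ein_minus_harm: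
  assumes n: "n > 0"
  shows "norm (Ein (of_nat n) - of_real (harm n)) \<le> 1 / n"
proof -
  \<comment> \<open>an antiderivative of \<open>(1 - (1 - z / n) ^ n) / z\<close>, by the geometric sum\<close>
  define P :: "complex \<Rightarrow> complex" where
    "P z = (\<Sum>k<n. (1 - (1 - z / of_nat n) ^ Suc k) / of_nat (Suc k))" for z
  define F where "F u = Ein (of_real u) - P (of_real u)" for u
  define F' :: "real \<Rightarrow> complex" where "F' u = ((1 - u / n) ^ n - exp (- u)) / u" for u
  define \<phi> where "\<phi> u = - (u + 1) * exp (- u) / n" for u
  have P': "(P has_field_derivative (1 - (1 - z / of_nat n) ^ n) / z) (at z)" if "z \<noteq> 0" for z
  proof -
    let ?q = "1 - z / of_nat n"
    have "(P has_field_derivative (\<Sum>k<n. ?q ^ k / of_nat n)) (at z)"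
      unfolding P_def [abs_def]
    proof (rule DERIV_sum)
      fix k
      have "((\<lambda>z. 1 - (1 - z / of_nat n) ^ Suc k) has_field_derivative of_nat (Suc k) * (?q ^ k / of_nat n)) (at z)"
        using n by (auto intro!: derivative_eq_intros simp del: of_nat_Suc power_Suc)
      from DERIV_cdivide[OF this, of "of_nat (Suc k)"]
      show "((\<lambda>z. (1 - (1 - z / of_nat n) ^ Suc k) / of_nat (Suc k)) has_field_derivative ?q ^ k / of_nat n) (at z)"
        by (simp del: of_nat_Suc power_Suc)
    qed
    also have "(\<Sum>k<n. ?q ^ k / of_nat n) = (\<Sum>k<n. ?q ^ k) / of_nat n"
      by (simp add: sum_divide_distrib)
    also have "\<dots> = (1 - ?q ^ n) / z"
      using that n by (simp add: sum_gp_strict)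
    finally show ?thesis .
  qed
  \<comment> \<open>\<open>\<phi>\<close> is an antiderivative of the majorant \<open>u * exp (- u) / n\<close> of the derivative of \<open>F\<close>\<close>
  have "norm (F n - F 0) \<le> \<phi> n - \<phi> 0"
  proof (rule differentiable_bound_general)
    show "0 < real n" using n by simp
    show "continuous_on {0..real n} F" unfolding F_def P_def
      by (intro continuous_intros) (use n in \<open>auto simp del: of_nat_Suc\<close>)
    show "continuous_on {0..real n} \<phi>" unfolding \<phi>_def
      by (intro continuous_intros) (use n in auto)
    fix u assume u: "0 < u" "u < real n"
    show "(F has_vector_derivative F' u) (at u)"
      unfolding F_def
    proof (rule has_vector_derivative_real_field)
      show "((\<lambda>z. Ein z - P z) has_field_derivative F' u) (at (of_real u))"
        using u
        by (auto intro!: derivative_eq_intros has_field_derivative_Ein P' 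
              simp: F'_def field_simps exp_of_real[symmetric] simp del: exp_of_real)
    qed
    show "(\<phi> has_vector_derivative (u * exp (- u) / n)) (at u)"
      unfolding \<phi>_def has_real_derivative_iff_has_vector_derivative[symmetric]
      using n by (auto intro!: derivative_eq_intros simp: field_simps)
    have "F' u = of_real (((1 - u / n) ^ n - exp (- u)) / u)"
      by (simp add: F'_def)
    then have "norm (F' u) = \<bar>(1 - u / n) ^ n - exp (- u)\<bar> / u"
      using u by (simp only: norm_of_real) simp
    also have "\<dots> \<le> (u\<^sup>2 * exp (- u) / n) / u"
      using exp_minus_power_approx[of n u] n u by (intro divide_right_mono) auto
    also have "\<dots> = u * exp (- u) / n"
      using u by (simp add: power2_eq_square)
    finally show "norm (F' u) \<le> u * exp (- u) / n" .
  qed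
  also have "\<phi> n - \<phi> 0 \<le> 1 / n"
    using n by (simp add: \<phi>_def field_simps)
  finally show ?thesis
    using n by (simp add: F_def P_def harm_altdef divide_inverse)
qed

text \<open>
  In the right half-plane \<open>Ein z - Ln z\<close> has the derivative \<open>- exp (- z) / z\<close>, so it changes by
  \<open>O(1 / M)\<close> along the segment from \<open>- \<i> w M\<close> to the positive integer \<open>M\<close>, where its value is
  close to \<open>harm M - ln M\<close>. The real and imaginary parts of the limit are the asymptotics of the cosine
  and the sine integral.
\<close>
lemma Ein_imaginary_asymptotics:
  assumes w: "w \<ge> 1"
  shows "(\<lambda>m. Ein (- \<i> * w * real (Suc m)) - ln (real (Suc m)))
           \<longlonglongrightarrow> of_real (euler_mascheroni + ln w) - \<i> * pi / 2"
proof -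
  define D where "D z = Ein z - Ln z" for z
  have bound: "norm (D (of_nat M) - D (- \<i> * w * real M)) \<le> 2 * (1 + w) / M"
    if M: "M > 0" for M :: nat
  proof -
    define \<gamma> :: "complex \<Rightarrow> complex" where "\<gamma> s = M * (s - \<i> * w * (1 - s))" for s
    have \<gamma>: "\<gamma> (of_real s) = Complex (M * s) (- (M * (w * (1 - s))))" for s :: real
      by (simp add: \<gamma>_def complex_eq_iff)
    have nonneg: "\<gamma> (of_real s) \<notin> \<real>\<^sub>\<le>\<^sub>0" if "0 \<le> s" "s \<le> 1" for s
      using that w M unfolding complex_nonpos_Reals_iff \<gamma> by auto
    define f' where "f' s = - exp (- \<gamma> (of_real s)) / \<gamma> (of_real s) * (M * (1 + \<i> * w))" for s :: real
    define \<phi> where "\<phi> s = - (2 * (1 + w) / M) * exp (- (M * s))" for s :: real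
    have "norm (D (\<gamma> (of_real 1)) - D (\<gamma> (of_real 0))) \<le> \<phi> 1 - \<phi> 0"
    proof (rule differentiable_bound_general)
      show "continuous_on {0..1} (\<lambda>s. D (\<gamma> (of_real s)))"
        unfolding D_def 
        by (intro continuous_intros) (use nonneg in \<open>auto simp: \<gamma>_def intro!: continuous_intros\<close>)
      show "continuous_on {0..1} \<phi>" unfolding \<phi>_def
        by (intro continuous_intros)
      fix s :: real assume s: "0 < s" "s < 1"
      have nz: "\<gamma> (of_real s) \<noteq> 0" using nonneg[of s] s by auto
      have gd: "(\<gamma> has_field_derivative (M * (1 + \<i> * w))) (at (of_real s))"
        unfolding \<gamma>_def by (auto intro!: derivative_eq_intros simp: algebra_simps)
      have dd: "(D has_field_derivative (- exp (- \<gamma> (of_real s)) / \<gamma> (of_real s))) (at (\<gamma> (of_real s)))"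
        unfolding D_def using nonneg[of s] nz s
        by (auto intro!: derivative_eq_intros has_field_derivative_Ein simp: field_simps)
      show "((\<lambda>s. D (\<gamma> (of_real s))) has_vector_derivative f' s) (at s)"
        unfolding f'_def
        by (rule has_vector_derivative_real_field) (rule DERIV_chain2[OF dd gd])
      show "(\<phi> has_vector_derivative (2 * (1 + w) * exp (- (M * s)))) (at s)"
        unfolding \<phi>_def has_real_derivative_iff_has_vector_derivative[symmetric]
        using M by (auto intro!: derivative_eq_intros simp: field_simps)
      \<comment> \<open>the segment stays away from the origin, since \<open>w \<ge> 1\<close>\<close>
      have "M / 2 \<le> norm (\<gamma> (of_real s))"
      proof (cases "s \<ge> 1 / 2")
        case True
        then have "M / 2 \<le> \<bar>Re (\<gamma> (of_real s))\<bar>" using M s by (simp add: \<gamma>)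
        then show ?thesis using abs_Re_le_cmod order_trans by blast
      next
        case False
        then have "1 * (1/2) \<le> w * (1 - s)" using w s by (intro mult_mono) auto
        then have "real M * (1 / 2) \<le> M * (w * (1 - s))" by (intro mult_left_mono) auto
        then have "M / 2 \<le> \<bar>Im (\<gamma> (of_real s))\<bar>" using M s w by (simp add: \<gamma> abs_mult)
        then show ?thesis using abs_Im_le_cmod order_trans by blast
      qed
      moreover have "norm (1 + \<i> * w) \<le> 1 + w"
        using norm_triangle_ineq[of 1 "\<i> * complex_of_real w"] w by (simp add: norm_mult)
      ultimately have "norm (f' s) \<le> exp (- (M * s)) / (M / 2) * (M * (1 + w))"
        unfolding f'_def norm_mult norm_divide norm_minus_cancel norm_exp_eq_Re
        using M w by (intro mult_mono frac_le) (auto simp: \<gamma>)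
      also have "\<dots> = 2 * (1 + w) * exp (- (M * s))"
        using M by simp
      finally show "norm (f' s) \<le> 2 * (1 + w) * exp (- (M * s))" .
    qed auto
    also have "\<phi> 1 - \<phi> 0 \<le> 2 * (1 + w) / M" using w M by (simp add: \<phi>_def)
    finally show ?thesis by (simp add: \<gamma>_def mult_ac)
  qed
  have "(\<lambda>m. 2 * (1 + w) / real (Suc m)) \<longlonglongrightarrow> 0"
    by (rule LIMSEQ_Suc[OF lim_const_over_n])
  then have l1: "(\<lambda>m. D (of_nat (Suc m)) - D (- \<i> * w * real (Suc m))) \<longlonglongrightarrow> 0"
    by (rule Lim_null_comparison[rotated])
       (intro always_eventually allI bound, simp)
  have "(\<lambda>m. 1 / real (Suc m)) \<longlonglongrightarrow> 0"
    by (rule LIMSEQ_Suc[OF lim_const_over_n])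
  then have l2: "(\<lambda>m. Ein (of_nat (Suc m)) - of_real (harm (Suc m))) \<longlonglongrightarrow> 0"
    by (rule Lim_null_comparison[rotated])
       (intro always_eventually allI norm_Ein_minus_harm, simp)
  have l3: "(\<lambda>m. of_real (harm (Suc m) - ln (real (Suc m))) :: complex) \<longlonglongrightarrow> of_real euler_mascheroni"
    by (intro tendsto_of_real LIMSEQ_Suc[OF euler_mascheroni_LIMSEQ])
  have "(\<lambda>m. (Ein (of_nat (Suc m)) - of_real (harm (Suc m)))
           + of_real (harm (Suc m) - ln (real (Suc m)))
           - (D (of_nat (Suc m)) - D (- \<i> * w * real (Suc m))) + (of_real (ln w) - \<i> * pi / 2))
         \<longlonglongrightarrow> 0 + of_real euler_mascheroni - 0 + (of_real (ln w) - \<i> * pi / 2)"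
    by (intro tendsto_add tendsto_diff l1 l2 l3 tendsto_const)
  moreover have "Ln (- \<i> * w * real (Suc m)) = of_real (ln (real (Suc m))) + (of_real (ln w) - \<i> * pi / 2)" for m
  proof -
    have "Ln (- \<i> * w * real (Suc m)) = Ln (of_real (w * real (Suc m)) * (- \<i>))"
      by (simp add: mult_ac)
    also have "\<dots> = of_real (ln (w * real (Suc m))) + Ln (- \<i>)"
      using w Ln_times_of_real[of "w * real (Suc m)" "- \<i>"] Ln_of_real[of "w * real (Suc m)"]
      by (simp del: of_nat_Suc of_real_mult)
    finally show ?thesis using w by (simp add: ln_mult del: of_nat_Suc)
  qed
  moreover have "Ln (of_nat (Suc m)) = of_real (ln (real (Suc m)))" for m
    using Ln_of_real[of "real (Suc m)"] by simp
  ultimately show ?thesis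
    unfolding D_def by (simp add: algebra_simps del: of_nat_Suc)
qed

section \<open>Integrals of logarithms\<close>

lemma abs_ln_le_inverse_sqrt:
  assumes "0 < x" "x \<le> (1::real)"
  shows "\<bar>ln x\<bar> \<le> 2 / sqrt x"
proof -
  have "ln (1 / sqrt x) \<le> 1 / sqrt x"
    using assms ln_bound[of "1 / sqrt x"] by simp
  then show ?thesis using assms by (simp add: ln_div ln_sqrt)
qed

lemma continuous_on_x_ln_x: "continuous_on {0..1} (\<lambda>x::real. x * ln x)"
proof -
  have "continuous (at x within {0..1}) (\<lambda>x::real. x * ln x)" if x: "x \<in> {0..1}" for x
  proof (cases "x = 0")
    case False
    then show ?thesis using x by (auto intro!: continuous_intros)
  next
    case True
    have "((\<lambda>y::real. 2 * sqrt y) \<longlongrightarrow> 2 * sqrt 0) (at 0 within {0..1})"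
      by (intro tendsto_intros)
    then have "((\<lambda>y::real. 2 * sqrt y) \<longlongrightarrow> 0) (at 0 within {0..1})" by simp
    moreover have "eventually (\<lambda>y::real. norm (y * ln y) \<le> 2 * sqrt y) (at 0 within {0..1})"
    proof (rule eventually_at_filter[THEN iffD2], rule always_eventually, intro allI impI)
      fix y :: real assume y: "y \<noteq> 0" "y \<in> {0..1}"
      then have "\<bar>y\<bar> * \<bar>ln y\<bar> \<le> y * (2 / sqrt y)"
        by (intro mult_mono abs_ln_le_inverse_sqrt) auto
      also have "\<dots> = 2 * (y / sqrt y)" by simp
      also have "\<dots> = 2 * sqrt y" using y by (subst real_div_sqrt) auto
      finally show "norm (y * ln y) \<le> 2 * sqrt y" by (simp add: abs_mult)
    qed
    ultimately have "((\<lambda>y::real. y * ln y) \<longlongrightarrow> 0) (at 0 within {0..1})"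
      by (rule Lim_null_comparison[rotated])
    then show ?thesis using True by (simp add: continuous_within)
  qed
  then show ?thesis by (simp add: continuous_on_eq_continuous_within)
qed

lemma integrable_ln: "(\<lambda>x::real. ln x) integrable_on {0<..<1}"
proof -
  have "((\<lambda>x::real. ln x) has_integral ((1 * ln 1 - 1) - (0 * ln 0 - 0))) {0..1}"
    by (rule fundamental_theorem_of_calculus_interior)
       (auto intro!: derivative_eq_intros continuous_intros continuous_on_x_ln_x
         simp flip: has_real_derivative_iff_has_vector_derivative)
  then show ?thesis
    using integrable_on_open_interval_real has_integral_integrable by blast
qed

lemma integrable_ln_square: "(\<lambda>x::real. (ln x)\<^sup>2) integrable_on {0<..<1}"
proof -
  have "continuous_on {0..1} (\<lambda>x::real. sqrt x * ln (sqrt x))"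
    by (rule continuous_on_compose2[OF continuous_on_x_ln_x]) (auto intro!: continuous_intros)
  from continuous_on_mult[OF continuous_on_const[of _ 4] continuous_on_power[OF this, of 2]]
  have "continuous_on {0..1} (\<lambda>x::real. 4 * (sqrt x * ln (sqrt x))\<^sup>2)" .
  moreover have "4 * (sqrt x * ln (sqrt x))\<^sup>2 = x * (ln x)\<^sup>2" if "x \<in> {0..1}" for x :: real
    using that by (cases "x = 0") (auto simp: ln_sqrt power_mult_distrib power_divide)
  ultimately have c: "continuous_on {0..1} (\<lambda>x::real. x * (ln x)\<^sup>2)"
    by (rule continuous_on_eq)
  let ?F = "\<lambda>x::real. x * (ln x)\<^sup>2 - 2 * (x * ln x) + 2 * x"
  have "((\<lambda>x::real. (ln x)\<^sup>2) has_integral (?F 1 - ?F 0)) {0..1}"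
  proof (rule fundamental_theorem_of_calculus_interior)
    fix x :: real assume "x \<in> {0<..<1}"
    then show "(?F has_vector_derivative (ln x)\<^sup>2) (at x)"
      unfolding has_real_derivative_iff_has_vector_derivative[symmetric]
      by (auto intro!: derivative_eq_intros simp: field_simps power2_eq_square)
  qed (auto intro!: continuous_intros continuous_on_x_ln_x c)
  then show ?thesis
    using integrable_on_open_interval_real has_integral_integrable by blast
qed

section \<open>Bounds for Gauss's product\<close>

text \<open>
  An integrable majorant for Gauss's product, independent of \<open>n\<close>. Apart from \<open>- ln x\<close>, the series is
  \<open>x ln n\<close> minus a sum of \<open>ln (1 + x / k)\<close>. By concavity that sum is at least \<open>x ln (n + 1)\<close>, and it is
  at most \<open>x harm n \<le> x (1 + ln n)\<close>, so the remaining part lies between \<open>-1\<close> and \<open>0\<close>.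
\<close>
lemma abs_ln_Gamma_series_le:
  assumes x: "0 < x" "x \<le> (1::real)"
  shows "\<bar>ln_Gamma_series x n\<bar> \<le> 1 - ln x"
proof (cases "n = 0")
  case True
  then show ?thesis using x by (simp add: ln_Gamma_series_def)
next
  case False
  define T where "T = x * ln (real n) - (\<Sum>k=1..n. ln (x / real k + 1))"
  have "x * ln (1 + 1 / real k) \<le> ln (x / real k + 1)" if "k \<ge> 1" for k
  proof -
    have "(1 - x) * ln 1 + x * ln (1 + 1 / real k) \<le> ln ((1 - x) *\<^sub>R 1 + x *\<^sub>R (1 + 1 / real k))"
      by (rule concave_onD[OF ln_concave]) (use x in \<open>auto intro: add_pos_nonneg\<close>)
    then show ?thesis by (simp add: algebra_simps)
  qed
  then have "(\<Sum>k=1..n. x * ln (1 + 1 / real k)) \<le> (\<Sum>k=1..n. ln (x / real k + 1))"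
    by (intro sum_mono) auto
  moreover have "(\<Sum>k=1..n. x * ln (1 + 1 / real k)) = x * ln (real (Suc n))"
  proof -
    have "(\<Sum>k=1..n. ln (1 + 1 / real k)) = ln (real (Suc n))"
    proof (induction n)
      case (Suc n)
      have "ln (1 + 1 / real (Suc n)) = ln (real (Suc (Suc n)) / real (Suc n))"
        by (rule arg_cong[of _ _ ln]) (simp add: field_simps)
      also have "\<dots> = ln (real (Suc (Suc n))) - ln (real (Suc n))"
        by (simp add: ln_div)
      finally show ?case using Suc by simp
    qed auto
    then show ?thesis by (simp add: sum_distrib_left[symmetric])
  qed
  moreover have "x * ln (real n) \<le> x * ln (real (Suc n))"
    using x False by (intro mult_left_mono) auto
  ultimately have T0: "T \<le> 0" unfolding T_def by linarith
  have "(\<Sum>k=1..n. ln (x / real k + 1)) \<le> (\<Sum>k=1..n. x / real k)"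
    using x by (intro sum_mono) (simp add: add.commute ln_add_one_self_le_self)
  also have "\<dots> = x * harm n"
    by (simp add: harm_def sum_distrib_left divide_inverse)
  also have "\<dots> \<le> x * (1 + ln (real n))"
    using euler_mascheroni_sequence_decreasing[of 1 n] False x
    by (intro mult_left_mono) (auto simp: harm_def)
  finally have "T \<ge> - x" by (simp add: T_def algebra_simps)
  then have "- 1 \<le> T" using x by linarith
  moreover have "ln_Gamma_series x n = T - ln x" by (simp add: ln_Gamma_series_def T_def)
  moreover have "ln x \<le> 0" using x by simp
  ultimately show ?thesis using T0 by linarith
qed

lemma ln_Gamma_series_tendsto:
  "(0::real) < x \<Longrightarrow> ln_Gamma_series x \<longlonglongrightarrow> ln (Gamma x)"
  using ln_Gamma_real_LIMSEQ[of x] by (simp add: ln_Gamma_real_pos)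

lemma abs_ln_Gamma_le:
  assumes "0 < x" "x \<le> (1::real)"
  shows "\<bar>ln (Gamma x)\<bar> \<le> 1 - ln x"
  by (rule LIMSEQ_le_const2[OF tendsto_rabs[OF ln_Gamma_series_tendsto]])
     (use assms abs_ln_Gamma_series_le in auto)

lemma integrable_ln_Gamma: "(\<lambda>x::real. ln (Gamma x)) integrable_on {0<..<1}"
proof (rule dominated_convergence(1)[where f = "\<lambda>n x. ln_Gamma_series x n" and h = "\<lambda>x. 1 - ln x"])
  show "(\<lambda>x::real. 1 - ln x) integrable_on {0<..<1}"
    by (intro integrable_diff integrable_ln) (simp add: integrable_on_open_interval_real integrable_const_ivl)
  have "continuous_on {0..1} (\<lambda>x. ln (x / real k + 1))" for k
    by (cases "k = 0") (auto intro!: continuous_intros simp: add_nonneg_eq_0_iff)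
  then have i: "(\<lambda>x. ln (x / real k + 1)) integrable_on {0<..<1}" for k
    by (simp add: integrable_on_open_interval_real integrable_continuous_interval)
  have "(\<lambda>x::real. x * ln (real n)) integrable_on {0<..<1}" for n
    unfolding integrable_on_open_interval_real
    by (intro integrable_continuous_interval continuous_intros)
  then show "(\<lambda>x::real. ln_Gamma_series x n) integrable_on {0<..<1}" for n
    unfolding ln_Gamma_series_def
    by (intro integrable_diff integrable_sum i integrable_ln) auto
qed (use abs_ln_Gamma_series_le ln_Gamma_series_tendsto in auto)

section \<open>The Fourier coefficients of the logarithm of the Gamma function\<close>

text \<open>
  Integration by parts with the boundary term \<open>exp (\<i> w x) - 1\<close>, which vanishes at integers because
  \<open>w\<close> is a multiple of \<open>2 \<pi>\<close>; what is left is a difference of values of \<open>Ein\<close>, so summing over \<open>k\<close>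
  telescopes. At \<open>x = 0\<close> and \<open>k = 0\<close> the zero of the boundary term compensates the singularity of the logarithm.
\<close>
lemma has_integral_ln_times_exp:
  assumes n: "n > (0::nat)" and w: "w = 2 * pi * real n"
  shows "((\<lambda>x. of_real (ln (x + real k)) * exp (\<i> * of_real (w * x))) has_integral
           (Ein (- \<i> * w * real (Suc k)) - Ein (- \<i> * w * real k)) / (\<i> * w)) {0<..<1}"
proof -
  have wpos: "w > 0" using n w by simp
  have per: "exp (\<i> * of_real (w * (x + real k))) = exp (\<i> * of_real (w * x))" for x
  proof -
    have "\<i> * of_real (w * (x + real k)) = \<i> * of_real (w * x) + of_int (2 * int (n * k)) * pi * \<i>"
      by (simp add: w algebra_simps)
    then show ?thesis unfolding exp_eq by blast
  qed
  define F where "F x = (exp (\<i> * of_real (w * x)) - 1) / (\<i> * w) * of_real (ln (x + real k))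
                        + Ein (- \<i> * w * of_real (x + real k)) / (\<i> * w)" for x
  have "((\<lambda>x. of_real (ln (x + real k)) * exp (\<i> * of_real (w * x))) has_integral (F 1 - F 0)) {0..1}"
  proof (rule fundamental_theorem_of_calculus_interior)
    have "continuous_on {0..1} (\<lambda>x. (exp (\<i> * of_real (w * x)) - 1) * of_real (ln (x + real k)) :: complex)"
    proof (cases "k = 0")
      case False
      then show ?thesis by (auto intro!: continuous_intros)
    next
      case True
      have "continuous (at x within {0..1}) (\<lambda>x. (exp (\<i> * of_real (w * x)) - 1) * of_real (ln x) :: complex)"
        if x: "x \<in> {0..1}" for x
      proof (cases "x = 0")
        case False
        then show ?thesis using x by (auto intro!: continuous_intros)
      next
        case True
        have "((\<lambda>x::real. x * ln x) \<longlongrightarrow> 0) (at 0 within {0..1})"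
          using continuous_on_x_ln_x by (auto simp: continuous_on_def dest!: bspec[of _ _ 0])
        then have "((\<lambda>x::real. w * \<bar>x * ln x\<bar>) \<longlongrightarrow> 0) (at 0 within {0..1})"
          by (intro tendsto_mult_right_zero tendsto_rabs_zero)
        moreover have "norm ((exp (\<i> * of_real (w * y)) - 1) * of_real (ln y) :: complex) \<le> w * \<bar>y * ln y\<bar>" for y
        proof -
          have "norm (exp (\<i> * of_real (w * y)) - 1) = 2 * \<bar>sin (w * y / 2)\<bar>"
            using dist_exp_i_1[of "w * y"] by (simp add: dist_norm)
          also have "\<dots> \<le> \<bar>w * y\<bar>" using abs_sin_x_le_abs_x[of "w * y / 2"] by (simp add: abs_mult)
          finally have "norm (exp (\<i> * of_real (w * y)) - 1) * \<bar>ln y\<bar> \<le> \<bar>w * y\<bar> * \<bar>ln y\<bar>"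
            by (rule mult_right_mono) simp
          then show ?thesis using wpos by (simp add: norm_mult abs_mult mult_ac)
        qed
        then have "eventually (\<lambda>y. norm ((exp (\<i> * of_real (w * y)) - 1) * of_real (ln y) :: complex)
                     \<le> w * \<bar>y * ln y\<bar>) (at 0 within {0..1})"
          by (intro always_eventually allI)
        ultimately have "((\<lambda>y. (exp (\<i> * of_real (w * y)) - 1) * of_real (ln y) :: complex) \<longlongrightarrow> 0) (at 0 within {0..1})"
          by (rule Lim_null_comparison[rotated])
        then show ?thesis using True by (simp add: continuous_within)
      qed
      then show ?thesis using True by (simp add: continuous_on_eq_continuous_within)
    qed
    moreover have "continuous_on {0..1} (\<lambda>x. Ein (- \<i> * w * of_real (x + real k)))"
      by (intro continuous_intros)
    ultimately have "continuous_on {0..1} (\<lambda>x. ((exp (\<i> * of_real (w * x)) - 1) * of_real (ln (x + real k))) / (\<i> * w)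
                 + Ein (- \<i> * w * of_real (x + real k)) / (\<i> * w) :: complex)"
      by (intro continuous_on_add continuous_on_divide continuous_on_const) (use wpos in auto)
    then show "continuous_on {0..1} F" by (simp add: F_def [abs_def])
  next
    fix x :: real assume x: "x \<in> {0<..<1}"
    let ?H = "\<lambda>z. (exp (\<i> * w * z) - 1) / (\<i> * w) * Ln (z + of_nat k) + Ein (- \<i> * w * (z + of_nat k)) / (\<i> * w)"
    have pos: "x + real k > 0" using x by (simp add: add_pos_nonneg)
    have nz: "complex_of_real x + of_nat k \<noteq> 0"
      using pos by (metis of_real_add of_real_eq_0_iff of_real_of_nat_eq less_irrefl)
    have np: "complex_of_real x + of_nat k \<notin> \<real>\<^sub>\<le>\<^sub>0"
      using pos by (auto simp: complex_nonpos_Reals_iff)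
    have "((\<lambda>z. ?H z) has_field_derivative of_real (ln (x + real k)) * exp (\<i> * of_real (w * x))) (at (of_real x))"
    proof -
      have e: "exp (\<i> * w * (of_real x + of_nat k)) = exp (\<i> * w * of_real x)"
        using per[of x] by (simp add: mult.assoc)
      have l: "Ln (of_real x + of_nat k) = of_real (ln (x + real k))"
        using Ln_of_real[OF pos] by simp
      have "((\<lambda>z. ?H z) has_field_derivative
         (exp (\<i> * w * x) * (\<i> * w) / (\<i> * w) * Ln (of_real x + of_nat k) + 
          (exp (\<i> * w * x) - 1) / (\<i> * w) * (1 / (of_real x + of_nat k))
           + (if - \<i> * w * (of_real x + of_nat k) = 0 then 1 else (1 - exp (- (- \<i> * w * (of_real x + of_nat k)))) / (- \<i> * w * (of_real x + of_nat k))) 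
              * (- \<i> * w) / (\<i> * w))) (at (of_real x))"
        using nz np wpos
        by (auto intro!: derivative_eq_intros DERIV_chain2[OF has_field_derivative_Ein] simp: divide_simps)
      also have "(exp (\<i> * w * x) * (\<i> * w) / (\<i> * w) * Ln (of_real x + of_nat k) + 
          (exp (\<i> * w * x) - 1) / (\<i> * w) * (1 / (of_real x + of_nat k))
           + (if - \<i> * w * (of_real x + of_nat k) = 0 then 1 else (1 - exp (- (- \<i> * w * (of_real x + of_nat k)))) / (- \<i> * w * (of_real x + of_nat k))) 
              * (- \<i> * w) / (\<i> * w)) = of_real (ln (x + real k)) * exp (\<i> * of_real (w * x))"
        using nz wpos e l by (simp add: divide_simps) (simp add: algebra_simps)
      finally show ?thesis .
    qed
    from has_vector_derivative_real_field[OF this]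
    have "((\<lambda>x. ?H (of_real x)) has_vector_derivative of_real (ln (x + real k)) * exp (\<i> * of_real (w * x))) (at x)" .
    then show "(F has_vector_derivative of_real (ln (x + real k)) * exp (\<i> * of_real (w * x))) (at x)"
    proof (rule has_vector_derivative_transform_within_open[where S = "{0<..<1}"])
      fix y :: real assume "y \<in> {0<..<1}"
      then have "y + real k > 0" by (simp add: add_pos_nonneg)
      from Ln_of_real[OF this] show "?H (of_real y) = F y"
        by (simp add: F_def mult.assoc)
    qed (use x in auto)
  qed auto
  moreover have "exp (\<i> * of_real (w * 1)) = 1"
  proof -
    have "\<i> * of_real (w * 1) = of_int (2 * int n) * pi * \<i>"
      by (simp add: w algebra_simps)
    then show ?thesis unfolding exp_eq_1 by (auto intro!: exI[of _ "int n"])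
  qed
  then have "F 1 - F 0 = (Ein (- \<i> * w * real (Suc k)) - Ein (- \<i> * w * real k)) / (\<i> * w)"
    by (simp add: F_def diff_divide_distrib add.commute)
  ultimately show ?thesis by (simp add: has_integral_Icc_iff_Ioo)
qed

lemma exp_2pi_i_nat: "exp (\<i> * of_real (2 * pi * real n)) = 1"
proof -
  have "\<i> * of_real (2 * pi * real n) = of_int (2 * int n) * pi * \<i>" by simp
  then show ?thesis unfolding exp_eq_1 by (auto intro!: exI[of _ "int n"])
qed

lemma has_integral_exp:
  assumes "c \<noteq> (0::real)"
  shows "((\<lambda>x. exp (\<i> * of_real (c * x))) has_integral (exp (\<i> * of_real c) - 1) / (\<i> * c)) {0<..<1}"
proof -
  let ?F = "\<lambda>x::real. exp (\<i> * of_real (c * x)) / (\<i> * c)"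
  have "((\<lambda>x. exp (\<i> * of_real (c * x))) has_integral (?F 1 - ?F 0)) {0..1}"
  proof (rule fundamental_theorem_of_calculus)
    fix x :: real
    have "((\<lambda>z. exp (\<i> * (c * z)) / (\<i> * c)) has_field_derivative exp (\<i> * of_real (c * x))) (at (of_real x))"
      using assms by (auto intro!: derivative_eq_intros simp: algebra_simps)
    from has_vector_derivative_real_field[OF this]
    show "(?F has_vector_derivative exp (\<i> * of_real (c * x))) (at x within {0..1})" by simp
  qed auto
  then show ?thesis by (simp add: has_integral_Icc_iff_Ioo diff_divide_distrib)
qed

lemma has_integral_times_exp:
  assumes "c \<noteq> (0::real)"
  shows "((\<lambda>x. of_real x * exp (\<i> * of_real (c * x))) has_integral
           (exp (\<i> * of_real c) / (\<i> * c) + (exp (\<i> * of_real c) - 1) / c\<^sup>2)) {0<..<1}"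
proof -
  let ?F = "\<lambda>x::real. of_real x * exp (\<i> * of_real (c * x)) / (\<i> * c) + exp (\<i> * of_real (c * x)) / c\<^sup>2"
  have "((\<lambda>x. of_real x * exp (\<i> * of_real (c * x))) has_integral (?F 1 - ?F 0)) {0..1}"
  proof (rule fundamental_theorem_of_calculus)
    fix x :: real
    have "((\<lambda>z. z * exp (\<i> * (c * z)) / (\<i> * c) + exp (\<i> * (c * z)) / c\<^sup>2) has_field_derivative 
             of_real x * exp (\<i> * of_real (c * x))) (at (of_real x))"
      using assms by (auto intro!: derivative_eq_intros simp: field_simps power2_eq_square)
    from has_vector_derivative_real_field[OF this]
    show "(?F has_vector_derivative of_real x * exp (\<i> * of_real (c * x))) (at x within {0..1})" by simp
  qed auto
  then show ?thesis by (simp add: has_integral_Icc_iff_Ioo diff_divide_distrib add_diff_eq)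
qed

text \<open>
  Gauss's product turns the integral over \<open>[0, 1]\<close> into one over \<open>[0, m + 1]\<close> of \<open>ln y * exp (\<i> w y)\<close>,
  because the exponential has period \<open>1\<close>.
\<close>
lemma has_integral_ln_Gamma_series_exp:
  assumes n: "n > (0::nat)" and w: "w = 2 * pi * real n"
  shows "((\<lambda>x. of_real (ln_Gamma_series x m) * exp (\<i> * of_real (w * x))) has_integral
           (of_real (ln (real m)) - Ein (- \<i> * w * real (Suc m))) / (\<i> * w)) {0<..<1}"
proof -
  let ?e = "\<lambda>x::real. exp (\<i> * of_real (w * x))"
  let ?E = "\<lambda>k::nat. Ein (- \<i> * w * real k)"
  have w0: "w \<noteq> 0" using n w by simp
  have ew: "exp (\<i> * of_real w) = 1" unfolding w by (rule exp_2pi_i_nat)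
  have e0: "(?e has_integral 0) {0<..<1}"
    using has_integral_exp[OF w0] unfolding ew by simp
  have e1: "((\<lambda>x. of_real x * ?e x) has_integral 1 / (\<i> * w)) {0<..<1}"
    using has_integral_times_exp[OF w0] unfolding ew by simp
  have e2: "((\<lambda>x. of_real (ln (x + real k)) * ?e x) has_integral (?E (Suc k) - ?E k) / (\<i> * w)) {0<..<1}" for k
    by (rule has_integral_ln_times_exp[OF n w])
  have e3: "((\<lambda>x. of_real (ln (x + real k)) * ?e x - of_real (ln (real k)) * ?e x) has_integral
             (?E (Suc k) - ?E k) / (\<i> * w) - of_real (ln (real k)) * 0) {0<..<1}" for k
    by (intro has_integral_diff e2 has_integral_mult_right e0)
  have "((\<lambda>x. of_real (ln (real m)) * (of_real x * ?e x) - of_real (ln (x + real 0)) * ?e x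
           - (\<Sum>k=1..m. of_real (ln (x + real k)) * ?e x - of_real (ln (real k)) * ?e x))
         has_integral (of_real (ln (real m)) * (1 / (\<i> * w)) - (?E (Suc 0) - ?E 0) / (\<i> * w)
           - (\<Sum>k=1..m. (?E (Suc k) - ?E k) / (\<i> * w) - of_real (ln (real k)) * 0))) {0<..<1}"
    by (intro has_integral_diff has_integral_sum has_integral_mult_right e1 e2 e3) auto
  also have "of_real (ln (real m)) * (1 / (\<i> * w)) - (?E (Suc 0) - ?E 0) / (\<i> * w)
           - (\<Sum>k=1..m. (?E (Suc k) - ?E k) / (\<i> * w) - of_real (ln (real k)) * 0)
       = (of_real (ln (real m)) - ?E (Suc m)) / (\<i> * w)"
  proof -
    have "(\<Sum>k=1..m. (?E (Suc k) - ?E k) / (\<i> * w)) = (?E (Suc m) - ?E 1) / (\<i> * w)"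
      by (induction m) (auto simp: diff_divide_distrib simp del: of_nat_Suc)
    then show ?thesis by (simp add: diff_divide_distrib)
  qed
  finally show ?thesis
  proof (rule has_integral_eq[rotated])
    fix x :: real assume x: "x \<in> {0<..<1}"
    have "ln (x / real k + 1) = ln (x + real k) - ln (real k)" if "k \<in> {1..m}" for k
    proof -
      have "x / real k + 1 = (x + real k) / real k" using that by (simp add: field_simps)
      then show ?thesis using that x by (simp add: ln_div add_pos_nonneg)
    qed
    then have "(\<Sum>k=1..m. of_real (ln (x + real k)) * ?e x - of_real (ln (real k)) * ?e x)
             = of_real (\<Sum>k=1..m. ln (x / real k + 1)) * ?e x"
      by (simp add: sum_distrib_right left_diff_distrib)
    then show "of_real (ln (real m)) * (of_real x * ?e x) - of_real (ln (x + real 0)) * ?e x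
           - (\<Sum>k=1..m. of_real (ln (x + real k)) * ?e x - of_real (ln (real k)) * ?e x)
         = of_real (ln_Gamma_series x m) * ?e x"
      by (simp add: ln_Gamma_series_def algebra_simps)
  qed
qed

text \<open>
  Kummer's Fourier coefficients of \<open>ln \<Gamma>\<close>, as the limit of those of Gauss's product.
\<close>
lemma has_integral_ln_Gamma_exp:
  assumes n: "n > (0::nat)" and w: "w = 2 * pi * real n"
  shows "((\<lambda>x. of_real (ln (Gamma x)) * exp (\<i> * of_real (w * x))) has_integral
           Complex (1 / (4 * real n)) ((euler_mascheroni + ln w) / w)) {0<..<1}"
proof (rule has_integral_dominated_convergence[OF has_integral_ln_Gamma_series_exp[OF n w]])
  show "(\<lambda>x::real. 1 - ln x) integrable_on {0<..<1}"
    by (intro integrable_diff integrable_ln) (simp add: integrable_on_open_interval_real integrable_const_ivl)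
  show "\<forall>x\<in>{0<..<1}. norm (of_real (ln_Gamma_series x m) * exp (\<i> * of_real (w * x))) \<le> 1 - ln x" for m
    using abs_ln_Gamma_series_le by (auto simp: norm_mult)
  show "\<forall>x\<in>{0<..<1}. (\<lambda>m. of_real (ln_Gamma_series x m) * exp (\<i> * of_real (w * x)))
           \<longlonglongrightarrow> of_real (ln (Gamma x)) * exp (\<i> * of_real (w * x))"
    by (auto intro!: tendsto_mult tendsto_of_real ln_Gamma_series_tendsto)
  have "2 * pi * 1 \<le> w" unfolding w using n by (intro mult_left_mono) auto
  then have w1: "w \<ge> 1" using pi_ge_two by linarith
  have "(\<lambda>m. ln (real (Suc m) / real m)) \<longlonglongrightarrow> ln 1"
    by (intro tendsto_ln LIMSEQ_Suc_n_over_n) auto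
  then have "(\<lambda>m. of_real (ln (real (Suc m) / real m)) :: complex) \<longlonglongrightarrow> of_real (ln 1)"
    by (rule tendsto_of_real)
  then have l0: "(\<lambda>m. of_real (ln (real (Suc m) / real m)) :: complex) \<longlonglongrightarrow> 0" by simp
  have "(\<lambda>m. (- (Ein (- \<i> * w * real (Suc m)) - of_real (ln (real (Suc m)))) - of_real (ln (real (Suc m) / real m))) / (\<i> * w))
     \<longlonglongrightarrow> (- (of_real (euler_mascheroni + ln w) - \<i> * pi / 2) - 0) / (\<i> * w)"
    by (intro tendsto_intros l0 Ein_imaginary_asymptotics w1) (use w1 in auto)
  also have "(- (of_real (euler_mascheroni + ln w) - \<i> * pi / 2) - 0) / (\<i> * w)
      = Complex (1 / (4 * real n)) ((euler_mascheroni + ln w) / w)"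
    using w1 n by (simp add: complex_eq_iff Re_divide Im_divide power2_eq_square w
          del: of_real_euler_mascheroni) (simp add: field_simps)
  finally show "(\<lambda>m. (of_real (ln (real m)) - Ein (- \<i> * w * real (Suc m))) / (\<i> * w))
       \<longlonglongrightarrow> Complex (1 / (4 * real n)) ((euler_mascheroni + ln w) / w)"
  proof (rule Lim_transform_eventually)
    show "eventually (\<lambda>m. (- (Ein (- \<i> * w * real (Suc m)) - of_real (ln (real (Suc m)))) - of_real (ln (real (Suc m) / real m))) / (\<i> * w)
       = (of_real (ln (real m)) - Ein (- \<i> * w * real (Suc m))) / (\<i> * w)) sequentially"
      using eventually_gt_at_top[of 0] by eventually_elim (simp add: ln_div)
  qed
qed

lemma ln_Gamma_duplication:
  assumes "x > (0::real)"
  shows "ln (Gamma x) + ln (Gamma (x + 1 / 2)) = (1 - 2 * x) * ln 2 + ln pi / 2 + ln (Gamma (2 * x))"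
proof -
  have "complex_of_real (Gamma x * Gamma (x + 1 / 2)) =
        complex_of_real (exp ((1 - 2 * x) * ln 2) * sqrt pi * Gamma (2 * x))"
  proof -
    have "complex_of_real x + 1 / 2 = complex_of_real (x + 1 / 2)"
         "2 * complex_of_real x = complex_of_real (2 * x)"
         "(1 - complex_of_real (2 * x)) * of_real (ln 2) = complex_of_real ((1 - 2 * x) * ln 2)"
      by simp_all
    note eqs = this
    have np: "complex_of_real y \<notin> \<int>\<^sub>\<le>\<^sub>0" if "y > 0" for y
      using that by (auto simp: of_real_in_nonpos_Ints_iff)
    have "complex_of_real x \<notin> \<int>\<^sub>\<le>\<^sub>0" using assms by (rule np)
    moreover have "complex_of_real x + 1 / 2 \<notin> \<int>\<^sub>\<le>\<^sub>0"
      unfolding eqs using assms by (intro np) simp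
    ultimately have "Gamma (complex_of_real x) * Gamma (complex_of_real x + 1 / 2) =
        exp ((1 - 2 * complex_of_real x) * of_real (ln 2)) * of_real (sqrt pi) * Gamma (2 * complex_of_real x)"
      by (rule Gamma_legendre_duplication)
    then show ?thesis
      unfolding eqs exp_of_real Gamma_complex_of_real by (simp only: of_real_mult)
  qed
  then have "Gamma x * Gamma (x + 1 / 2) = exp ((1 - 2 * x) * ln 2) * sqrt pi * Gamma (2 * x)"
    unfolding of_real_eq_iff .
  then have "ln (Gamma x * Gamma (x + 1 / 2)) = ln (exp ((1 - 2 * x) * ln 2) * sqrt pi * Gamma (2 * x))"
    by simp
  moreover have "Gamma x \<noteq> 0" "Gamma (x + 1 / 2) \<noteq> 0" "Gamma (2 * x) \<noteq> 0"
    using assms by (auto intro!: Gamma_real_pos less_imp_neq[THEN not_sym])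
  ultimately show ?thesis
    by (simp add: ln_mult ln_sqrt)
qed

text \<open>
  The mean value of \<open>ln \<Gamma>\<close> (Raabe). Integrating the duplication formula over \<open>[0, 1/2]\<close> gives
  \<open>I = ln 2 / 4 + ln \<pi> / 4 + I / 2\<close> for the integral \<open>I\<close>.
\<close>
lemma integral_ln_Gamma: "((\<lambda>x::real. ln (Gamma x)) has_integral ln (2 * pi) / 2) {0<..<1}"
proof -
  let ?G = "\<lambda>x::real. ln (Gamma x)"
  define I where "I = integral {0..1} ?G"
  define I1 where "I1 = integral {0..1/2} ?G"
  define I2 where "I2 = integral {1/2..1} ?G"
  have int: "?G integrable_on {0..1}"
    using integrable_ln_Gamma by (simp add: integrable_on_open_interval_real)
  have hI: "(?G has_integral I) {0..1}" unfolding I_def using int by (rule integrable_integral)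
  have hI1: "(?G has_integral I1) {0..1/2}"
    unfolding I1_def by (intro integrable_integral integrable_on_subinterval[OF int]) auto
  have hI2: "(?G has_integral I2) {1/2..1}"
    unfolding I2_def by (intro integrable_integral integrable_on_subinterval[OF int]) auto
  have sum: "I1 + I2 = I"
    unfolding I_def I1_def I2_def by (intro Henstock_Kurzweil_Integration.integral_combine int) auto
  have s1: "((\<lambda>x. ?G (2 * x)) has_integral I / 2) {0..1/2}"
    using has_integral_stretch_real[OF hI, of 2] by simp
  have s2: "((\<lambda>x. ?G (x + 1 / 2)) has_integral I2) {0..1/2}"
    using has_integral_affinity'[of ?G I2 "1/2" 1 1 "1/2"] hI2 by simp
  have "((\<lambda>x. (1 - 2 * x) * ln 2 + ln pi / 2) has_integral ln 2 / 4 + ln pi / 4) {0..1/2}"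
  proof -
    let ?F = "\<lambda>x::real. (x - x\<^sup>2) * ln 2 + x * (ln pi / 2)"
    have "((\<lambda>x. (1 - 2 * x) * ln 2 + ln pi / 2) has_integral ?F (1/2) - ?F 0) {0..1/2}"
      by (rule fundamental_theorem_of_calculus)
         (auto intro!: derivative_eq_intros simp flip: has_real_derivative_iff_has_vector_derivative)
    then show ?thesis by (simp add: power2_eq_square)
  qed
  from has_integral_add[OF this s1]
  have "((\<lambda>x. (1 - 2 * x) * ln 2 + ln pi / 2 + ?G (2 * x)) has_integral ln 2 / 4 + ln pi / 4 + I / 2) {0<..<1/2}"
    by (simp add: has_integral_Icc_iff_Ioo)
  moreover have "((\<lambda>x. ?G x + ?G (x + 1 / 2)) has_integral I1 + I2) {0<..<1/2}"
    using has_integral_add[OF hI1 s2] by (simp add: has_integral_Icc_iff_Ioo)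
  then have "((\<lambda>x. (1 - 2 * x) * ln 2 + ln pi / 2 + ?G (2 * x)) has_integral I1 + I2) {0<..<1/2}"
    by (rule has_integral_eq[rotated]) (simp add: ln_Gamma_duplication)
  ultimately have "ln 2 / 4 + ln pi / 4 + I / 2 = I1 + I2"
    by (rule has_integral_unique)
  then have "I = ln (2 * pi) / 2" using sum by (simp add: ln_mult)
  with hI show ?thesis by (simp only: has_integral_Icc_iff_Ioo)
qed

section \<open>The Fourier series of a wave of non-integral frequency\<close>

text \<open>
  Up to a constant factor, this is the symmetric partial sum of the Fourier series of
  \<open>exp (\<i> \<pi> p x)\<close> on \<open>(0, 1)\<close>: the coefficient at frequency \<open>n\<close> is \<open>1 / (2 n - p)\<close>, and the
  frequencies \<open>n\<close> and \<open>- n\<close> are added together.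
\<close>
definition wave_sum :: "real \<Rightarrow> nat \<Rightarrow> real \<Rightarrow> complex" where
  "wave_sum p N x = - 1 / of_real p + (\<Sum>n=1..N.
      exp (\<i> * of_real (2 * pi * real n * x)) / of_real (2 * real n - p)
    - exp (\<i> * of_real (- (2 * pi * real n) * x)) / of_real (2 * real n + p))"

lemma not_even_integer_nonzero:
  assumes "\<not> (\<exists>k::int. p = 2 * of_int k)"
  shows "p \<noteq> 0" "2 * real n - p \<noteq> 0" "2 * real n + p \<noteq> 0" "4 * (real n)\<^sup>2 - p\<^sup>2 \<noteq> 0"
proof -
  have "p \<noteq> 2 * of_int 0" "p \<noteq> 2 * of_int (int n)" "p \<noteq> 2 * of_int (- int n)" using assms by blast+
  then show 1: "p \<noteq> 0" "2 * real n - p \<noteq> 0" "2 * real n + p \<noteq> 0" by auto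
  have "4 * (real n)\<^sup>2 - p\<^sup>2 = (2 * real n - p) * (2 * real n + p)" by (simp add: power2_eq_square algebra_simps)
  then show "4 * (real n)\<^sup>2 - p\<^sup>2 \<noteq> 0" using 1 by simp
qed

lemma exp_pi_not_even_integer:
  assumes p: "\<not> (\<exists>k::int. p = 2 * of_int k)"
  shows "exp (\<i> * of_real (pi * p)) \<noteq> 1"
proof
  assume "exp (\<i> * of_real (pi * p)) = 1"
  then obtain k :: int where "pi * p = of_int (2 * k) * pi" by (auto simp: exp_eq_1)
  then have "p = 2 * of_int k" by simp
  with p show False by blast
qed

lemma Dirichlet_kernel:
  "(1 + (\<Sum>n=1..N. 2 * cos (2 * pi * real n * x))) * sin (pi * x) = sin ((2 * real N + 1) * pi * x)"
proof (induction N)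
  case (Suc N)
  have "2 * cos (2 * pi * real (Suc N) * x) * sin (pi * x)
        = sin ((2 * real (Suc N) + 1) * pi * x) - sin ((2 * real N + 1) * pi * x)"
    using cos_times_sin[of "2 * pi * real (Suc N) * x" "pi * x"] by (simp add: algebra_simps)
  then show ?case using Suc by (simp add: algebra_simps)
qed auto

text \<open>
  Multiplying by \<open>exp (- \<i> \<pi> p x)\<close> makes differentiation cancel the denominators \<open>2 n - p\<close> and \<open>2 n + p\<close>. The
  derivative is then a multiple of the Dirichlet kernel, so the convergence of the Fourier series
  can be read off from an antiderivative.
\<close>
lemma wave_sum_has_vector_derivative:
  assumes p: "\<not> (\<exists>k::int. p = 2 * of_int k)" and x: "0 < x" "x < 1"
  shows "((\<lambda>x. exp (\<i> * of_real (- pi * p * x)) * wave_sum p N x) has_vector_derivative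
           \<i> * pi * exp (\<i> * of_real (- pi * p * x)) * of_real (sin ((2 * real N + 1) * pi * x) / sin (pi * x))) (at x)"
proof -
  note nz = not_even_integer_nonzero[OF p]
  have nz': "- p \<noteq> 0" "- (2 * real n + p) \<noteq> 0" for n
    using nz(1) nz(3)[of n] by linarith+
  let ?e = "\<lambda>c z. exp (\<i> * (of_real c * z))"
  have e: "((\<lambda>z. ?e (pi * a) z / of_real a) has_field_derivative \<i> * pi * ?e (pi * a) z) (at z)"
    if "a \<noteq> 0" for a z
    using that by (auto intro!: derivative_eq_intros)
  have "((\<lambda>z. ?e (pi * (- p)) z / of_real (- p) + (\<Sum>n=1..N.
      ?e (pi * (2 * real n - p)) z / of_real (2 * real n - p)
    + ?e (pi * (- (2 * real n + p))) z / of_real (- (2 * real n + p)))) has_field_derivative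
      (\<i> * pi * ?e (pi * (- p)) z + (\<Sum>n=1..N. \<i> * pi * ?e (pi * (2 * real n - p)) z
         + \<i> * pi * ?e (pi * (- (2 * real n + p))) z))) (at z)" for z
    by (intro DERIV_add DERIV_sum e nz nz')
  from has_vector_derivative_real_field[OF this]
  have "((\<lambda>x. ?e (pi * (- p)) (of_real x) / of_real (- p) + (\<Sum>n=1..N.
      ?e (pi * (2 * real n - p)) (of_real x) / of_real (2 * real n - p)
    + ?e (pi * (- (2 * real n + p))) (of_real x) / of_real (- (2 * real n + p)))) has_vector_derivative
      (\<i> * pi * ?e (pi * (- p)) (of_real x) + (\<Sum>n=1..N. \<i> * pi * ?e (pi * (2 * real n - p)) (of_real x)
         + \<i> * pi * ?e (pi * (- (2 * real n + p))) (of_real x)))) (at x)" .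
  moreover have split: "?e (pi * (2 * real n - p)) (of_real x) = exp (\<i> * of_real (- pi * p * x)) * exp (\<i> * of_real (2 * pi * real n * x))"
       "?e (pi * (- (2 * real n + p))) (of_real x) = exp (\<i> * of_real (- pi * p * x)) * exp (\<i> * of_real (- (2 * pi * real n) * x))"
       "?e (pi * (- p)) (of_real x) = exp (\<i> * of_real (- pi * p * x))"
     for n and x :: real
    by (simp_all add: exp_add[symmetric] algebra_simps)
  moreover have "?e (pi * (- p)) (of_real x) / of_real (- p) + (\<Sum>n=1..N.
      ?e (pi * (2 * real n - p)) (of_real x) / of_real (2 * real n - p)
    + ?e (pi * (- (2 * real n + p))) (of_real x) / of_real (- (2 * real n + p)))
    = exp (\<i> * of_real (- pi * p * x)) * wave_sum p N x" for x :: real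
    unfolding wave_sum_def split distrib_left sum_distrib_left
    by (simp only: of_real_minus divide_minus_right) (simp add: right_diff_distrib)
  moreover have "\<i> * pi * ?e (pi * (- p)) (of_real x) + (\<Sum>n=1..N. \<i> * pi * ?e (pi * (2 * real n - p)) (of_real x)
         + \<i> * pi * ?e (pi * (- (2 * real n + p))) (of_real x))
      = \<i> * pi * exp (\<i> * of_real (- pi * p * x)) * of_real (sin ((2 * real N + 1) * pi * x) / sin (pi * x))"
  proof -
    have "sin (pi * x) > 0" using x by (intro sin_gt_zero) auto
    then have "sin ((2 * real N + 1) * pi * x) / sin (pi * x) = 1 + (\<Sum>n=1..N. 2 * cos (2 * pi * real n * x))"
      using Dirichlet_kernel[of x N] by (simp add: field_simps)
    moreover have "exp (\<i> * of_real (2 * pi * real n * x)) + exp (\<i> * of_real (- (2 * pi * real n) * x))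
        = of_real (2 * cos (2 * pi * real n * x))" for n
      by (simp add: exp_Euler exp_minus_Euler flip: cos_of_real)
    ultimately show ?thesis
      unfolding split by (simp add: sum_distrib_left distrib_left[symmetric] mult.assoc)
         (simp add: algebra_simps sum_distrib_left)
  qed
  ultimately show ?thesis by simp
qed

text \<open>
  The mean value inequality with a variable bound \<open>\<phi>'\<close>, which replaces the integral of \<open>\<phi>'\<close> in the
  estimates below by the values of \<open>\<phi>\<close>.
\<close>
lemma norm_diff_le_of_derivative_bound:
  fixes f :: "real \<Rightarrow> 'a::real_normed_vector"
  assumes "\<And>x. x \<in> {l<..<u} \<Longrightarrow> (f has_vector_derivative f' x) (at x)"
    and "\<And>x. x \<in> {l<..<u} \<Longrightarrow> (\<phi> has_real_derivative \<phi>' x) (at x)"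
    and "\<And>x. x \<in> {l<..<u} \<Longrightarrow> norm (f' x) \<le> \<phi>' x"
    and "a \<in> {l<..<u}" "b \<in> {l<..<u}"
  shows "norm (f b - f a) \<le> \<bar>\<phi> b - \<phi> a\<bar>"
proof -
  have *: "norm (f b - f a) \<le> \<phi> b - \<phi> a" if "a < b" "a \<in> {l<..<u}" "b \<in> {l<..<u}" for a b
  proof (rule differentiable_bound_general[where f' = f' and \<phi>' = \<phi>', OF that(1)])
    have sub: "{a..b} \<subseteq> {l<..<u}" using that by auto
    show "continuous_on {a..b} f"
      by (intro continuous_at_imp_continuous_on ballI has_vector_derivative_continuous[OF assms(1)])
         (use sub in auto)
    show "continuous_on {a..b} \<phi>"
      by (intro continuous_at_imp_continuous_on ballI DERIV_isCont[OF assms(2)]) (use sub in auto)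
  qed (use assms(1-3) that in \<open>auto simp flip: has_real_derivative_iff_has_vector_derivative\<close>)
  show ?thesis
    using *[of a b] *[of b a] assms(4,5) by (cases a b rule: linorder_cases) (auto simp: norm_minus_commute)
qed

lemma abs_ln_tan_le:
  assumes x: "0 < x" "x < (1::real)"
  shows "\<bar>ln (tan (pi * x / 2))\<bar> \<le> - ln x - ln (1 - x)"
proof -
  have tan_ge: "ln y \<le> ln (tan (pi * y / 2))" if "0 < y" "y < 1" for y
  proof -
    have "y * 2 \<le> y * pi" using that pi_ge_two by (intro mult_left_mono) auto
    then have "y \<le> pi * y / 2" by (simp add: mult.commute)
    also have "\<dots> \<le> \<bar>tan (pi * y / 2)\<bar>"
      using abs_tan_ge[of "pi * y / 2"] that by (simp add: abs_mult)
    also have "\<dots> = tan (pi * y / 2)"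
      using tan_gt_zero[of "pi * y / 2"] that by simp
    finally show ?thesis using that by simp
  qed
  have "tan (pi * (1 - x) / 2) = inverse (tan (pi * x / 2))"
    using tan_cot[of "pi * x / 2"] by (simp add: algebra_simps diff_divide_distrib)
  moreover have "tan (pi * x / 2) > 0" using x by (intro tan_gt_zero) auto
  ultimately have "ln (tan (pi * (1 - x) / 2)) = - ln (tan (pi * x / 2))" by (simp add: ln_inverse)
  moreover have "ln x \<le> 0" "ln (1 - x) \<le> 0" using x by auto
  moreover have "ln x \<le> ln (tan (pi * x / 2))" "ln (1 - x) \<le> ln (tan (pi * (1 - x) / 2))"
    using x by (auto intro!: tan_ge)
  ultimately show ?thesis by linarith
qed

text \<open>
  The crude estimate \<open>1 / sin (\<pi> y)\<close> of the Dirichlet kernel has the antiderivative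
  \<open>ln (tan (\<pi> y / 2)) / \<pi>\<close>. It does not tend to \<open>0\<close> with \<open>N\<close>, but it is uniform in \<open>N\<close> and only
  logarithmic at the end points, hence good enough for a majorant.
\<close>
lemma wave_sum_variation:
  assumes p: "\<not> (\<exists>k::int. p = 2 * of_int k)" and x: "0 < x" "x < 1"
  shows "norm (exp (\<i> * of_real (- pi * p * x)) * wave_sum p N x
               - exp (\<i> * of_real (- pi * p * (1/2))) * wave_sum p N (1/2)) \<le> - ln x - ln (1 - x)"
proof -
  have "norm (exp (\<i> * of_real (- pi * p * x)) * wave_sum p N x
               - exp (\<i> * of_real (- pi * p * (1/2))) * wave_sum p N (1/2))
     \<le> \<bar>ln (tan (pi * x / 2)) - ln (tan (pi * (1/2) / 2))\<bar>"
  proof (rule norm_diff_le_of_derivative_bound[where l = 0 and u = 1])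
    fix y :: real assume y: "y \<in> {0<..<1}"
    then show "((\<lambda>x. exp (\<i> * of_real (- pi * p * x)) * wave_sum p N x) has_vector_derivative
           \<i> * pi * exp (\<i> * of_real (- pi * p * y)) * of_real (sin ((2 * real N + 1) * pi * y) / sin (pi * y))) (at y)"
      by (intro wave_sum_has_vector_derivative p) auto
    have pos: "tan (pi * y / 2) > 0" "cos (pi * y / 2) > 0" "sin (pi * y / 2) > 0" "sin (pi * y) > 0"
      using y by (auto intro!: tan_gt_zero cos_gt_zero sin_gt_zero)
    have s: "sin (pi * y) = 2 * sin (pi * y / 2) * cos (pi * y / 2)"
      using sin_double[of "pi * y / 2"] by simp
    show "((\<lambda>y. ln (tan (pi * y / 2))) has_real_derivative pi / sin (pi * y)) (at y)"
    proof -
      have "((\<lambda>y. ln (tan (pi * y / 2))) has_real_derivative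
               inverse ((cos (pi * y / 2))\<^sup>2) * (pi / 2) / tan (pi * y / 2)) (at y)"
        using pos by (auto intro!: derivative_eq_intros)
      also have "inverse ((cos (pi * y / 2))\<^sup>2) * (pi / 2) / tan (pi * y / 2) = pi / sin (pi * y)"
        using pos unfolding s tan_def by (simp add: field_simps power2_eq_square)
      finally show ?thesis .
    qed
    have "norm (\<i> * pi * exp (\<i> * of_real (- pi * p * y)) * of_real (sin ((2 * real N + 1) * pi * y) / sin (pi * y)))
       = pi * (\<bar>sin ((2 * real N + 1) * pi * y)\<bar> / sin (pi * y))"
      unfolding norm_mult norm_of_real using pos by simp
    also have "\<dots> \<le> pi * (1 / sin (pi * y))"
      using pos by (intro mult_left_mono divide_right_mono) auto
    finally show "norm (\<i> * pi * exp (\<i> * of_real (- pi * p * y)) * of_real (sin ((2 * real N + 1) * pi * y) / sin (pi * y)))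
        \<le> pi / sin (pi * y)" by simp
  qed (use x in auto)
  also have "\<dots> \<le> - ln x - ln (1 - x)"
    using abs_ln_tan_le[OF x] by (simp add: tan_45)
  finally show ?thesis .
qed

text \<open>
  A Riemann-Lebesgue argument: for \<open>M = 2 N + 1\<close>, adding the term \<open>b\<close> of size \<open>O(1 / M)\<close> replaces the
  derivative, an oscillating factor \<open>sin (M \<pi> y)\<close> times \<open>w\<close>, by one that contains \<open>w' / M\<close> and is
  therefore small uniformly between \<open>x\<close> and \<open>1/2\<close>.
\<close>
lemma wave_sum_diff_tendsto:
  assumes p: "\<not> (\<exists>k::int. p = 2 * of_int k)" and x: "0 < x" "x < 1"
  shows "(\<lambda>N. exp (\<i> * of_real (- pi * p * x)) * wave_sum p N x
               - exp (\<i> * of_real (- pi * p * (1/2))) * wave_sum p N (1/2)) \<longlonglongrightarrow> 0"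
proof -
  define e where "e y = exp (\<i> * of_real (- pi * p * y))" for y
  define w where "w y = e y / of_real (sin (pi * y))" for y
  define w' where "w' y = (- \<i> * pi * p * e y * sin (pi * y) - e y * (pi * cos (pi * y))) / (sin (pi * y))\<^sup>2" for y :: real
  define l where "l = min x (1/2) / 2"
  define u where "u = (1 + max x (1/2)) / 2"
  have lu: "0 < l" "u < 1" "l < u" "x \<in> {l<..<u}" "1/2 \<in> {l<..<u}"
    using x by (auto simp: l_def u_def min_def max_def)
  have "continuous_on {l..u} (\<lambda>y. sin (pi * y))" by (intro continuous_intros)
  then obtain y0 where y0: "y0 \<in> {l..u}" "\<And>y. y \<in> {l..u} \<Longrightarrow> sin (pi * y0) \<le> sin (pi * y)"
    using continuous_attains_inf[of "{l..u}" "\<lambda>y. sin (pi * y)"] lu(3) by auto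
  define s where "s = sin (pi * y0)"
  have s0: "s > 0" unfolding s_def using y0(1) lu by (intro sin_gt_zero) auto
  have s: "s \<le> sin (pi * y)" if "y \<in> {l<..<u}" for y using y0(2)[of y] that by (simp add: s_def)
  have ne [simp]: "norm (e y) = 1" for y by (simp add: e_def)
  define B where "B = (pi * \<bar>p\<bar> + pi) / s\<^sup>2"
  have dw: "(w has_vector_derivative w' y) (at y)" if y: "y \<in> {l<..<u}" for y
  proof -
    have nz: "sin (of_real pi * complex_of_real y) \<noteq> 0"
      using s[OF y] s0 by (metis of_real_eq_0_iff of_real_mult sin_of_real less_le_not_le)
    have "((\<lambda>z. exp (\<i> * (of_real (- pi * p) * z)) / sin (of_real pi * z)) has_field_derivative
           (- \<i> * pi * p * exp (\<i> * (of_real (- pi * p) * of_real y)) * sin (of_real pi * of_real y)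
              - exp (\<i> * (of_real (- pi * p) * of_real y)) * (pi * cos (complex_of_real pi * of_real y)))
             / (sin (of_real pi * of_real y))\<^sup>2) (at (of_real y))"
      using nz by (auto intro!: derivative_eq_intros simp: power2_eq_square)
    from has_vector_derivative_real_field[OF this]
    show ?thesis
      by (simp add: w_def [abs_def] w'_def e_def mult.assoc flip: sin_of_real cos_of_real)
  qed
  have bw': "norm (w' y) \<le> B" if y: "y \<in> {l<..<u}" for y
  proof -
    have "norm (w' y) = norm (- \<i> * pi * p * e y * sin (pi * y) - e y * (pi * cos (pi * y))) / (sin (pi * y))\<^sup>2"
      unfolding w'_def norm_divide by (simp add: norm_power)
    also have "\<dots> \<le> (pi * \<bar>p\<bar> * 1 + pi * 1) / s\<^sup>2"
    proof (intro frac_le)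
      have "norm (- \<i> * pi * p * e y * sin (pi * y) - e y * (pi * cos (pi * y)))
          \<le> pi * \<bar>p\<bar> * \<bar>sin (pi * y)\<bar> + pi * \<bar>cos (pi * y)\<bar>"
        by (rule order.trans[OF norm_triangle_ineq4]) (simp add: norm_mult)
      also have "\<dots> \<le> pi * \<bar>p\<bar> * 1 + pi * 1"
        by (intro add_mono mult_left_mono) auto
      finally show "norm (- \<i> * pi * p * e y * sin (pi * y) - e y * (pi * cos (pi * y))) \<le> pi * \<bar>p\<bar> * 1 + pi * 1" .
      show "s\<^sup>2 \<le> (sin (pi * y))\<^sup>2" using s[OF y] s0 by (intro power_mono) auto
    qed (use s0 in auto)
    finally show ?thesis by (simp add: B_def)
  qed
  have bound: "norm (e x * wave_sum p N x - e (1/2) * wave_sum p N (1/2))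
                 \<le> (B * \<bar>x - 1/2\<bar> + 2 / s) / real (Suc N)" for N
  proof -
    define M where "M = 2 * real N + 1"
    have M: "M > 0" by (simp add: M_def)
    define b where "b y = \<i> / M * cos (M * pi * y) * w y" for y :: real
    have b: "norm (b y) \<le> (1 / s) / M" if y: "y \<in> {l<..<u}" for y
    proof -
      have "norm (b y) = (1 / M) * \<bar>cos (M * pi * y)\<bar> * (1 / sin (pi * y))"
        using s[OF y] s0 M unfolding b_def w_def norm_mult norm_divide norm_of_real ne by simp
      also have "\<dots> \<le> (1 / M) * 1 * (1 / s)"
        using s[OF y] s0 M by (intro mult_mono divide_left_mono) auto
      finally show ?thesis by (simp add: mult.commute)
    qed
    have "norm ((e x * wave_sum p N x + b x) - (e (1/2) * wave_sum p N (1/2) + b (1/2)))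
            \<le> \<bar>B / M * x - B / M * (1/2)\<bar>"
    proof (rule norm_diff_le_of_derivative_bound[where l = l and u = u])
      fix y assume y: "y \<in> {l<..<u}"
      have 1: "((\<lambda>x. e x * wave_sum p N x) has_vector_derivative
           \<i> * pi * e y * of_real (sin (M * pi * y) / sin (pi * y))) (at y)"
        unfolding e_def M_def using y lu by (intro wave_sum_has_vector_derivative p) auto
      have 2: "((\<lambda>x. \<i> / M * cos (M * pi * x)) has_vector_derivative (- \<i> * pi * sin (M * pi * y))) (at y)"
      proof -
        have "((\<lambda>z. \<i> / M * cos (M * pi * z)) has_field_derivative (- \<i> * pi * sin (M * pi * complex_of_real y))) (at (of_real y))"
          using M by (auto intro!: derivative_eq_intros)
        from has_vector_derivative_real_field[OF this] show ?thesis by (simp flip: sin_of_real cos_of_real)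
      qed
      show "((\<lambda>y. e y * wave_sum p N y + b y) has_vector_derivative \<i> / M * cos (M * pi * y) * w' y) (at y)"
        unfolding b_def
        by (rule has_vector_derivative_eq_rhs[OF has_vector_derivative_add[OF 1 has_vector_derivative_mult[OF 2 dw[OF y]]]])
           (use M in \<open>simp add: w_def\<close>)
      show "((\<lambda>y. B / M * y) has_real_derivative B / M) (at y)"
        using M by (auto intro!: derivative_eq_intros)
      have "norm (\<i> / M * cos (M * pi * y) * w' y) \<le> 1 / M * 1 * B"
        unfolding norm_mult norm_divide norm_of_real using bw'[OF y] M by (intro mult_mono) auto
      then show "norm (\<i> / M * cos (M * pi * y) * w' y) \<le> B / M" by simp
    qed (use lu in auto)
    also have "\<bar>B / M * x - B / M * (1/2)\<bar> = B * \<bar>x - 1/2\<bar> / M"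
    proof -
      have "B / M * x - B / M * (1/2) = (B / M) * (x - 1/2)" by (simp add: algebra_simps)
      then show ?thesis using M by (simp add: abs_mult B_def)
    qed
    finally have "norm ((e x * wave_sum p N x + b x) - (e (1/2) * wave_sum p N (1/2) + b (1/2))) \<le> B * \<bar>x - 1/2\<bar> / M" .
    moreover have "norm (e x * wave_sum p N x - e (1/2) * wave_sum p N (1/2)) \<le>
        norm ((e x * wave_sum p N x + b x) - (e (1/2) * wave_sum p N (1/2) + b (1/2))) + norm (b x) + norm (b (1/2))"
    proof -
      have "e x * wave_sum p N x - e (1/2) * wave_sum p N (1/2) =
        (((e x * wave_sum p N x + b x) - (e (1/2) * wave_sum p N (1/2) + b (1/2))) - b x) + b (1/2)" by simp
      then show ?thesis by (metis (no_types, lifting) norm_triangle_le norm_triangle_ineq4 add_right_mono)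
    qed
    ultimately have "norm (e x * wave_sum p N x - e (1/2) * wave_sum p N (1/2)) \<le> B * \<bar>x - 1/2\<bar> / M + (1 / s) / M + (1 / s) / M"
      using b[OF lu(4)] b[OF lu(5)] by linarith
    also have "\<dots> = (B * \<bar>x - 1/2\<bar> + 2 / s) / M" by (simp add: add_divide_distrib)
    also have "\<dots> \<le> (B * \<bar>x - 1/2\<bar> + 2 / s) / real (Suc N)"
      using s0 by (intro divide_left_mono) (auto simp: M_def B_def)
    finally show ?thesis .
  qed
  have "(\<lambda>N. (B * \<bar>x - 1/2\<bar> + 2 / s) / real (Suc N)) \<longlonglongrightarrow> 0"
    by (rule LIMSEQ_Suc[OF lim_const_over_n])
  then show ?thesis
    unfolding e_def[symmetric] by (rule Lim_null_comparison[OF always_eventually[OF allI[OF bound]]])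
qed

text \<open>
  At the midpoint the terms at \<open>n\<close> and \<open>- n\<close> have the same phase, so that the denominators combine to
  the absolutely summable \<open>2 p / (4 n\<^sup>2 - p\<^sup>2)\<close>.
\<close>
lemma wave_sum_half_convergent:
  assumes p: "\<not> (\<exists>k::int. p = 2 * of_int k)"
  shows "convergent (\<lambda>N. wave_sum p N (1/2))"
proof -
  note nz = not_even_integer_nonzero[OF p]
  define a where "a n = exp (\<i> * of_real (2 * pi * real n * (1/2))) / of_real (2 * real n - p)
    - exp (\<i> * of_real (- (2 * pi * real n) * (1/2))) / of_real (2 * real n + p)" for n
  have norm_a: "norm (a n) = 2 * \<bar>p\<bar> / \<bar>4 * (real n)\<^sup>2 - p\<^sup>2\<bar>" for n
  proof -
    have "\<i> * of_real (- (2 * pi * real n) * (1/2)) = \<i> * of_real (2 * pi * real n * (1/2)) + of_int (2 * (- int n)) * pi * \<i>"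
      by (simp add: algebra_simps)
    then have eq: "exp (\<i> * of_real (- (2 * pi * real n) * (1/2))) = exp (\<i> * of_real (2 * pi * real n * (1/2)))"
      unfolding exp_eq by blast
    have "1 / (2 * real n - p) - 1 / (2 * real n + p) = 2 * p / (4 * (real n)\<^sup>2 - p\<^sup>2)"
      using nz(2)[of n] nz(3)[of n] nz(4)[of n] by (simp add: field_simps power2_eq_square)
    moreover have "a n = exp (\<i> * of_real (2 * pi * real n * (1/2))) * of_real (1 / (2 * real n - p) - 1 / (2 * real n + p))"
      unfolding a_def eq by (simp add: right_diff_distrib)
    ultimately have a_eq: "a n = exp (\<i> * of_real (2 * pi * real n * (1/2))) * of_real (2 * p / (4 * (real n)\<^sup>2 - p\<^sup>2))"
      by (simp only:)
    then show ?thesis unfolding a_eq norm_mult norm_of_real by (simp add: abs_mult)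
  qed
  have "summable (\<lambda>n. a (Suc n))"
  proof (rule summable_comparison_test_ev)
    show "eventually (\<lambda>n. norm (a (Suc n)) \<le> 2 * \<bar>p\<bar> * inverse ((real (Suc n))\<^sup>2)) sequentially"
      using eventually_ge_at_top[of "nat \<lceil>\<bar>p\<bar>\<rceil>"]
    proof eventually_elim
      case (elim n)
      then have "\<bar>p\<bar> \<le> real (Suc n)" by linarith
      then have "p\<^sup>2 \<le> (real (Suc n))\<^sup>2" by (simp add: abs_le_square_iff[symmetric] del: of_nat_Suc)
      then have "(real (Suc n))\<^sup>2 \<le> \<bar>4 * (real (Suc n))\<^sup>2 - p\<^sup>2\<bar>" by (auto simp del: of_nat_Suc simp: abs_if)
      then have "2 * \<bar>p\<bar> / \<bar>4 * (real (Suc n))\<^sup>2 - p\<^sup>2\<bar> \<le> 2 * \<bar>p\<bar> / (real (Suc n))\<^sup>2"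
        by (intro frac_le) auto
      then show ?case unfolding norm_a divide_inverse[symmetric] .
    qed
    show "summable (\<lambda>n. 2 * \<bar>p\<bar> * inverse ((real (Suc n))\<^sup>2))"
      using inverse_power_summable[of 2, where ?'a = real]
      by (intro summable_mult) (subst summable_Suc_iff, simp)
  qed
  then have "convergent (\<lambda>N. - 1 / of_real p + (\<Sum>n<N. a (Suc n)))"
    by (intro convergent_add convergent_const) (simp add: summable_iff_convergent)
  then show ?thesis
    by (simp add: wave_sum_def a_def sum.atLeast1_atMost_eq)
qed

text \<open>
  Pointwise convergence to a multiple of \<open>exp (\<i> \<pi> p x)\<close>, with a majorant. The factor \<open>h\<close> is
  identified only later, by integrating the constant function \<open>1\<close>.
\<close>
lemma wave_sum_limit:
  assumes p: "\<not> (\<exists>k::int. p = 2 * of_int k)"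
  obtains h C where "C \<ge> 0"
    "\<And>x. 0 < x \<Longrightarrow> x < 1 \<Longrightarrow> (\<lambda>N. wave_sum p N x) \<longlonglongrightarrow> h * exp (\<i> * of_real (pi * p * x))"
    "\<And>N x. 0 < x \<Longrightarrow> x < 1 \<Longrightarrow> norm (wave_sum p N x) \<le> C - ln x - ln (1 - x)"
proof -
  obtain L where L: "(\<lambda>N. wave_sum p N (1/2)) \<longlonglongrightarrow> L"
    using wave_sum_half_convergent[OF p] by (auto simp: convergent_def)
  let ?e = "\<lambda>x. exp (\<i> * of_real (- pi * p * x))"
  let ?h = "?e (1/2) * L"
  have h: "(\<lambda>N. ?e (1/2) * wave_sum p N (1/2)) \<longlonglongrightarrow> ?h"
    by (intro tendsto_mult L tendsto_const)
  obtain C where C: "norm (?e (1/2) * wave_sum p N (1/2)) \<le> C" for N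
    using BseqE[OF convergent_imp_Bseq[OF convergentI[OF h]]] by blast
  show ?thesis
  proof
    show "C \<ge> 0" using C[of 0] norm_ge_zero order_trans by blast
    fix x :: real assume x: "0 < x" "x < 1"
    have inv: "exp (\<i> * of_real (pi * p * x)) * ?e x = 1" by (simp flip: exp_add)
    have "(\<lambda>N. exp (\<i> * of_real (pi * p * x)) * ((?e x * wave_sum p N x - ?e (1/2) * wave_sum p N (1/2))
             + ?e (1/2) * wave_sum p N (1/2))) \<longlonglongrightarrow> exp (\<i> * of_real (pi * p * x)) * (0 + ?h)"
      by (intro tendsto_mult tendsto_add tendsto_const h wave_sum_diff_tendsto p x)
    then show "(\<lambda>N. wave_sum p N x) \<longlonglongrightarrow> ?h * exp (\<i> * of_real (pi * p * x))"
      by (simp only: diff_add_cancel mult.assoc[symmetric] inv mult_1 add_0) (simp add: mult_ac)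
    fix N
    have "norm (wave_sum p N x) = norm (?e x * wave_sum p N x)" by (simp add: norm_mult)
    also have "\<dots> \<le> norm (?e x * wave_sum p N x - ?e (1/2) * wave_sum p N (1/2)) + norm (?e (1/2) * wave_sum p N (1/2))"
      by (metis diff_add_cancel norm_triangle_ineq)
    also have "\<dots> \<le> (- ln x - ln (1 - x)) + C"
      by (intro add_mono wave_sum_variation p x C)
    finally show "norm (wave_sum p N x) \<le> C - ln x - ln (1 - x)" by simp
  qed
qed

section \<open>Parseval's identity for the wave\<close>

lemma integrable_ln_square_sum:
  "(\<lambda>x::real. c + a * (ln x)\<^sup>2 + b * (ln (1 - x))\<^sup>2) integrable_on {0<..<1}"
proof -
  have "(\<lambda>x::real. (ln x)\<^sup>2) integrable_on {0..1}"
    using integrable_ln_square by (simp add: integrable_on_open_interval_real)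
  from has_integral_affinity[OF integrable_integral[OF this[folded cbox_interval]], of "-1" 1]
  have "((\<lambda>x::real. (ln (1 - x))\<^sup>2) has_integral integral {0..1} (\<lambda>x::real. (ln x)\<^sup>2)) ((\<lambda>x. - x + 1) ` {0..1})"
    by simp
  also have "(\<lambda>x::real. - x + 1) ` {0..1} = {0..1}"
    by (auto simp: image_iff intro!: bexI[of _ "1 - _"])
  finally have "(\<lambda>x::real. (ln (1 - x))\<^sup>2) integrable_on {0<..<1}"
    using has_integral_integrable by (simp add: integrable_on_open_interval_real) blast
  moreover have "(\<lambda>x::real. c) integrable_on {0<..<1}"
    by (simp add: integrable_on_open_interval_real integrable_const_ivl)
  ultimately show ?thesis
    by (intro integrable_add integrable_on_mult_right integrable_ln_square)
qed

text \<open>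
  If \<open>A n\<close> are the Fourier coefficients of a real function, this is its integral against
  \<open>wave_sum p N\<close>; the coefficient at \<open>- n\<close> is the conjugate of \<open>A n\<close>.
\<close>
definition fourier_pairing :: "real \<Rightarrow> (nat \<Rightarrow> complex) \<Rightarrow> nat \<Rightarrow> complex" where
  "fourier_pairing p A N = - A 0 / of_real p + (\<Sum>n=1..N.
     A n / of_real (2 * real n - p) - cnj (A n) / of_real (2 * real n + p))"

lemma has_integral_times_wave_sum:
  fixes f :: "real \<Rightarrow> real"
  assumes A: "\<And>n. ((\<lambda>x. of_real (f x) * exp (\<i> * of_real (2 * pi * real n * x))) has_integral A n) {0<..<1}"
  shows "((\<lambda>x. of_real (f x) * wave_sum p N x) has_integral fourier_pairing p A N) {0<..<1}"
proof -
  have A': "((\<lambda>x. of_real (f x) * exp (\<i> * of_real (- (2 * pi * real n) * x))) has_integral cnj (A n)) {0<..<1}" for n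
  proof -
    have "cnj \<circ> (\<lambda>x. of_real (f x) * exp (\<i> * of_real (2 * pi * real n * x)))
       = (\<lambda>x. of_real (f x) * exp (\<i> * of_real (- (2 * pi * real n) * x)))"
      by (simp add: fun_eq_iff exp_cnj)
    with has_integral_cnj[THEN iffD2, OF A[of n]] show ?thesis by simp
  qed
  have "((\<lambda>x. - (of_real (f x) * exp (\<i> * of_real (2 * pi * real 0 * x))) / of_real p + (\<Sum>n=1..N.
      of_real (f x) * exp (\<i> * of_real (2 * pi * real n * x)) / of_real (2 * real n - p)
    - of_real (f x) * exp (\<i> * of_real (- (2 * pi * real n) * x)) / of_real (2 * real n + p)))
    has_integral fourier_pairing p A N) {0<..<1}"
    unfolding fourier_pairing_def
    by (intro has_integral_add has_integral_sum has_integral_diff has_integral_divide has_integral_neg A A') auto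
  then show ?thesis
    by (rule has_integral_eq[rotated])
       (simp add: wave_sum_def distrib_left sum_distrib_left right_diff_distrib)
qed

text \<open>
  A Parseval formula for \<open>f\<close> and \<open>exp (\<i> \<pi> p x)\<close>. Dominated convergence applies although \<open>f\<close> may
  be unbounded, since both \<open>f\<close> and the partial sums have only logarithmic singularities.
\<close>
lemma fourier_pairing_limit:
  assumes p: "\<not> (\<exists>k::int. p = 2 * of_int k)"
    and K: "K \<ge> 0" and f: "\<And>x. 0 < x \<Longrightarrow> x < 1 \<Longrightarrow> \<bar>f x\<bar> \<le> K - ln x"
    and A: "\<And>n. ((\<lambda>x. of_real (f x) * exp (\<i> * of_real (2 * pi * real n * x))) has_integral A n) {0<..<1}"
  shows "\<exists>J. ((\<lambda>x. of_real (f x) * exp (\<i> * of_real (pi * p * x))) has_integral J) {0<..<1} \<and>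
             fourier_pairing p A \<longlonglongrightarrow> - \<i> * pi / (exp (\<i> * of_real (pi * p)) - 1) * J"
proof -
  note nz = not_even_integer_nonzero[OF p]
  obtain h C where C: "C \<ge> 0"
    and lim: "\<And>x. 0 < x \<Longrightarrow> x < 1 \<Longrightarrow> (\<lambda>N. wave_sum p N x) \<longlonglongrightarrow> h * exp (\<i> * of_real (pi * p * x))"
    and bd: "\<And>N x. 0 < x \<Longrightarrow> x < 1 \<Longrightarrow> norm (wave_sum p N x) \<le> C - ln x - ln (1 - x)"
    using wave_sum_limit[OF p] by metis
  have main: "(\<lambda>x. of_real (f x) * (h * exp (\<i> * of_real (pi * p * x)))) integrable_on {0<..<1} \<and>
      fourier_pairing p A \<longlonglongrightarrow> integral {0<..<1} (\<lambda>x. of_real (f x) * (h * exp (\<i> * of_real (pi * p * x))))"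
    if K: "K \<ge> 0" and f: "\<And>x. 0 < x \<Longrightarrow> x < 1 \<Longrightarrow> \<bar>f x\<bar> \<le> K - ln x"
      and A: "\<And>n. ((\<lambda>x. of_real (f x) * exp (\<i> * of_real (2 * pi * real n * x))) has_integral A n) {0<..<1}"
    for K and f :: "real \<Rightarrow> real" and A
  proof -
    note hi = has_integral_times_wave_sum[OF A]
    let ?H = "\<lambda>x::real. (2 * K\<^sup>2 + 3 * C\<^sup>2) + 5 * (ln x)\<^sup>2 + 3 * (ln (1 - x))\<^sup>2"
    have 1: "(\<lambda>x. of_real (f x) * wave_sum p N x) integrable_on {0<..<1}" for N
      using hi by (rule has_integral_integrable)
    have 2: "norm (of_real (f x) * wave_sum p N x) \<le> ?H x" if x: "x \<in> {0<..<1}" for N x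
    proof -
      define a where "a = - ln x"
      define b where "b = - ln (1 - x)"
      have ab: "a \<ge> 0" "b \<ge> 0" using x by (auto simp: a_def b_def)
      have "norm (of_real (f x) * wave_sum p N x) \<le> (K + a) * (C + a + b)"
        unfolding norm_mult norm_of_real using f[of x] bd[of x N] x ab K
        by (intro mult_mono) (auto simp: a_def b_def)
      also have "\<dots> \<le> 2 * K\<^sup>2 + 3 * C\<^sup>2 + 5 * a\<^sup>2 + 3 * b\<^sup>2"
      proof -
        have "2 * (K + a) * (C + a + b) \<le> (K + a)\<^sup>2 + (C + a + b)\<^sup>2"
          by (rule sum_squares_bound)
        moreover have "(K + a)\<^sup>2 \<le> 2 * K\<^sup>2 + 2 * a\<^sup>2"
          using sum_squares_bound[of K a] by (simp add: power2_sum)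
        moreover have "(C + a + b)\<^sup>2 \<le> 3 * C\<^sup>2 + 3 * a\<^sup>2 + 3 * b\<^sup>2"
          using sum_squares_bound[of C a] sum_squares_bound[of a b] sum_squares_bound[of C b]
          by (simp add: power2_sum algebra_simps)
        moreover have "0 \<le> (K + a) * (C + a + b)" using ab K C by simp
        ultimately show ?thesis by linarith
      qed
      finally show ?thesis by (simp add: a_def b_def)
    qed
    have 3: "(\<lambda>N. of_real (f x) * wave_sum p N x) \<longlonglongrightarrow> of_real (f x) * (h * exp (\<i> * of_real (pi * p * x)))"
      if "x \<in> {0<..<1}" for x
      using that by (intro tendsto_mult tendsto_const lim) auto
    have "integral {0<..<1} (\<lambda>x. of_real (f x) * wave_sum p N x) = fourier_pairing p A N" for N
      using hi by (rule integral_unique)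
    with dominated_convergence[OF 1 integrable_ln_square_sum 2 3] show ?thesis by simp
  qed
  have p0: "pi * p \<noteq> 0" using nz(1) by simp
  note e1 = exp_pi_not_even_integer[OF p]
  \<comment> \<open>For the constant function \<open>1\<close> both sides are explicit, which determines \<open>h\<close>.\<close>
  have "((\<lambda>x. of_real 1 * exp (\<i> * of_real (2 * pi * real n * x))) has_integral (if n = 0 then 1 else 0)) {0<..<1}" for n
  proof (cases "n = 0")
    case True
    have "((\<lambda>x::real. 1::complex) has_integral 1) {0..1}"
      using has_integral_const_real[of "1::complex" 0 1] by simp
    then show ?thesis using True by (simp add: has_integral_Icc_iff_Ioo)
  next
    case False
    then show ?thesis using has_integral_exp[of "2 * pi * real n"] exp_2pi_i_nat[of n] by simp
  qed
  from main[of 1 "\<lambda>_. 1", OF _ _ this]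
  have "fourier_pairing p (\<lambda>n. if n = 0 then 1 else 0) \<longlonglongrightarrow>
           integral {0<..<1} (\<lambda>x. h * exp (\<i> * of_real (pi * p * x)))"
    by simp
  moreover have "fourier_pairing p (\<lambda>n. if n = 0 then 1 else 0) = (\<lambda>_. - 1 / of_real p)"
    by (simp add: fourier_pairing_def fun_eq_iff)
  ultimately have "- 1 / of_real p = integral {0<..<1} (\<lambda>x. h * exp (\<i> * of_real (pi * p * x)))"
    by (simp only: LIMSEQ_const_iff)
  also have "\<dots> = h * ((exp (\<i> * of_real (pi * p)) - 1) / (\<i> * of_real (pi * p)))"
    by (intro integral_unique has_integral_mult_right has_integral_exp[OF p0])
  finally have "- 1 / of_real p = h * ((exp (\<i> * of_real (pi * p)) - 1) / (\<i> * of_real (pi * p)))" .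
  then have h: "h = - \<i> * pi / (exp (\<i> * of_real (pi * p)) - 1)"
    using nz(1) e1 by (simp add: field_simps)
  then have h0: "h \<noteq> 0" using e1 by simp
  define J where "J = integral {0<..<1} (\<lambda>x. of_real (f x) * (h * exp (\<i> * of_real (pi * p * x)))) / h"
  from main[OF K f A] have "((\<lambda>x. of_real (f x) * (h * exp (\<i> * of_real (pi * p * x))) / h) has_integral J) {0<..<1}"
    unfolding J_def by (intro has_integral_divide integrable_integral) blast
  then have "((\<lambda>x. of_real (f x) * exp (\<i> * of_real (pi * p * x))) has_integral J) {0<..<1}"
    using h0 by simp
  moreover have "fourier_pairing p A \<longlonglongrightarrow> h * J"
    using main[OF K f A] h0 by (simp add: J_def)
  ultimately show ?thesis unfolding h by blast
qed

section \<open>The sine integral\<close>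

text \<open>
  Passing to \<open>Digamma (z + 1)\<close> and \<open>Digamma (1 - z)\<close> first makes the terms with \<open>z\<close> and \<open>- z\<close>
  combine index by index; the two corrections \<open>1 / z\<close> and \<open>- 1 / z\<close> cancel.
\<close>
lemma Digamma_add_minus:
  assumes z: "z \<notin> \<int>"
  shows "(\<lambda>n. - 2 * z\<^sup>2 / (real (Suc n) * ((real (Suc n))\<^sup>2 - z\<^sup>2))) sums
           (Digamma z + Digamma (- z) + 2 * euler_mascheroni)"
proof -
  have nz: "z \<noteq> 0" "z + 1 \<noteq> 0" "- z + 1 \<noteq> 0" "z + real (Suc n) \<noteq> 0" "- z + real (Suc n) \<noteq> 0" for n
  proof -
    have "z \<noteq> of_int k" for k using z by auto
    from this[of 0] this[of "-1"] this[of 1] this[of "- int (Suc n)"] this[of "int (Suc n)"]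
    show "z \<noteq> 0" "z + 1 \<noteq> 0" "- z + 1 \<noteq> 0" "z + real (Suc n) \<noteq> 0" "- z + real (Suc n) \<noteq> 0"
      by (auto simp: add_eq_0_iff)
  qed
  have s: "(\<lambda>n. inverse (real (Suc n)) - inverse (y + real n)) sums (Digamma y + euler_mascheroni)"
    if "y \<noteq> 0" for y
    using summable_sums[OF summable_Digamma[OF that]] by (simp add: Digamma_def)
  have "(\<lambda>n. (inverse (real (Suc n)) - inverse (z + 1 + real n)) + (inverse (real (Suc n)) - inverse (- z + 1 + real n)))
     sums ((Digamma (z + 1) + euler_mascheroni) + (Digamma (- z + 1) + euler_mascheroni))"
    by (intro sums_add s nz)
  also have "(\<lambda>n. (inverse (real (Suc n)) - inverse (z + 1 + real n)) + (inverse (real (Suc n)) - inverse (- z + 1 + real n)))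
     = (\<lambda>n. - 2 * z\<^sup>2 / (real (Suc n) * ((real (Suc n))\<^sup>2 - z\<^sup>2)))"
  proof
    fix n
    define m where "m = real (Suc n)"
    have m: "m \<noteq> 0" "z + m \<noteq> 0" "m - z \<noteq> 0" using nz(4,5)[of n] by (auto simp: m_def)
    have f: "m\<^sup>2 - z\<^sup>2 = (z + m) * (m - z)" by (simp add: power2_eq_square algebra_simps)
    have "(inverse m - inverse (z + m)) + (inverse m - inverse (m - z)) = - 2 * z\<^sup>2 / (m * (m\<^sup>2 - z\<^sup>2))"
      using m unfolding f by (simp add: divide_simps) (simp add: power2_eq_square algebra_simps)
    then show "(inverse (real (Suc n)) - inverse (z + 1 + real n)) + (inverse (real (Suc n)) - inverse (- z + 1 + real n))
        = - 2 * z\<^sup>2 / (real (Suc n) * ((real (Suc n))\<^sup>2 - z\<^sup>2))"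
      by (simp add: m_def algebra_simps)
  qed
  also have "(Digamma (z + 1) + euler_mascheroni) + (Digamma (- z + 1) + euler_mascheroni)
     = Digamma z + Digamma (- z) + 2 * euler_mascheroni"
    using Digamma_plus1[of z] Digamma_plus1[of "- z"] nz(1) by simp
  finally show ?thesis .
qed

text \<open>
  The linear term removes the part of Kummer's coefficients that decays like \<open>1 / n\<close>, so that only
  \<open>ln n / (2 \<pi> n)\<close> remains in the imaginary part. Its own integral against the sine is elementary and
  accounts for the cotangent term of the result.
\<close>
lemma ln_Gamma_plus_linear_coefficients:
  fixes c :: real
  defines "c \<equiv> euler_mascheroni + ln (2 * pi)"
  defines "A \<equiv> (\<lambda>n. if n = 0 then of_real (ln (2 * pi) / 2 + c / 2)
                   else Complex (1 / (4 * real n)) (ln (real n) / (2 * pi * real n)))"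
  shows "((\<lambda>x. of_real (ln (Gamma x) + c * x) * exp (\<i> * of_real (2 * pi * real n * x))) has_integral A n) {0<..<1}"
proof (cases "n = 0")
  case True
  have "((\<lambda>x::real. x) has_integral 1 / 2) {0<..<1}"
    using ident_has_integral[of 0 "1::real"] by (simp add: has_integral_Icc_iff_Ioo)
  then have "((\<lambda>x. ln (Gamma x) + c * x) has_integral ln (2 * pi) / 2 + c * (1 / 2)) {0<..<1}"
    by (intro has_integral_add integral_ln_Gamma has_integral_mult_right)
  from has_integral_linear[OF this bounded_linear_of_real[where ?'a = complex]]
  show ?thesis using True by (simp add: A_def o_def)
next
  case False
  define w where "w = 2 * pi * real n"
  have w0: "w \<noteq> 0" using False by (simp add: w_def)
  have ew: "exp (\<i> * of_real w) = 1" unfolding w_def by (rule exp_2pi_i_nat)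
  have "((\<lambda>x. of_real (ln (Gamma x)) * exp (\<i> * of_real (w * x)) + of_real c * (of_real x * exp (\<i> * of_real (w * x))))
    has_integral (Complex (1 / (4 * real n)) ((euler_mascheroni + ln w) / w)
        + of_real c * (exp (\<i> * of_real w) / (\<i> * w) + (exp (\<i> * of_real w) - 1) / w\<^sup>2))) {0<..<1}"
    using False w0
    by (intro has_integral_add has_integral_mult_right has_integral_ln_Gamma_exp has_integral_times_exp) (auto simp: w_def)
  also have "Complex (1 / (4 * real n)) ((euler_mascheroni + ln w) / w)
        + of_real c * (exp (\<i> * of_real w) / (\<i> * w) + (exp (\<i> * of_real w) - 1) / w\<^sup>2) = A n"
  proof -
    have "ln w = ln (2 * pi) + ln (real n)" using False by (simp add: w_def ln_mult)
    moreover have "of_real c / (\<i> * of_real w) = Complex 0 (- c / w)"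
      using w0 by (simp add: complex_eq_iff Re_divide Im_divide power2_eq_square)
    ultimately show ?thesis
      using False unfolding ew A_def
      by (simp add: complex_eq_iff c_def w_def[symmetric] add_divide_distrib[symmetric] diff_divide_distrib[symmetric])
  qed
  finally show ?thesis
    by (simp add: w_def distrib_right mult.assoc)
qed

text \<open>
  The imaginary part of the Parseval formula for \<open>ln \<Gamma>(x) + c x\<close>. The real part of its series is the
  Digamma series, and the imaginary part is the series with \<open>ln n\<close>, whose convergence is thereby
  obtained as well.
\<close>
lemma sine_integral_via_series:
  assumes p: "\<not> (\<exists>k::int. p = 2 * of_int k)"
  defines "c \<equiv> euler_mascheroni + ln (2 * pi)"
  shows "\<exists>T. (\<lambda>n. ln (real (Suc n)) / (4 * (real (Suc n))\<^sup>2 - p\<^sup>2)) sums T \<and>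
      ((\<lambda>x. ln (Gamma x) * sin (p * pi * x)) has_integral
         (1 - cos (p * pi)) / (p * pi) * (c + (Digamma (p / 2) + Digamma (- p / 2)) / 4)
         + c * cos (p * pi) / (p * pi) - c * sin (p * pi) / (p * pi)\<^sup>2
         - 2 * sin (p * pi) / pi\<^sup>2 * T) {0..1}"
proof -
  note nz = not_even_integer_nonzero[OF p]
  define A where "A n = (if n = 0 then of_real (ln (2 * pi) / 2 + c / 2)
                   else Complex (1 / (4 * real n)) (ln (real n) / (2 * pi * real n)))" for n
  define e where "e = exp (\<i> * of_real (pi * p))"
  have e: "Re e = cos (p * pi)" "Im e = sin (p * pi)" by (simp_all add: e_def Re_exp Im_exp mult.commute)
  have c0: "1 + \<bar>c\<bar> \<ge> 0" by simp
  have bound: "\<bar>ln (Gamma x) + c * x\<bar> \<le> (1 + \<bar>c\<bar>) - ln x" if x: "0 < x" "x < 1" for x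
  proof -
    have "\<bar>c * x\<bar> \<le> \<bar>c\<bar> * 1" unfolding abs_mult using x by (intro mult_left_mono) auto
    then show ?thesis using abs_ln_Gamma_le[of x] x by linarith
  qed
  obtain J where J: "((\<lambda>x. of_real (ln (Gamma x) + c * x) * exp (\<i> * of_real (pi * p * x))) has_integral J) {0<..<1}"
    and lim: "fourier_pairing p A \<longlonglongrightarrow> - \<i> * pi / (e - 1) * J"
    using fourier_pairing_limit[OF p c0 bound ln_Gamma_plus_linear_coefficients[folded c_def]]
    unfolding A_def [abs_def] e_def by blast
  define S where "S = - \<i> * pi / (e - 1) * J"
  have e1: "e \<noteq> 1" unfolding e_def by (rule exp_pi_not_even_integer[OF p])
  have "J = \<i> * S * (e - 1) / pi" using e1 by (simp add: S_def field_simps)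
  then have ImJ: "Im J = (Re S * (cos (p * pi) - 1) - Im S * sin (p * pi)) / pi"
    by (simp add: e Re_divide Im_divide power2_eq_square)

  have re: "Re (A n / of_real (2 * real n - p) - cnj (A n) / of_real (2 * real n + p)) = p / (2 * real n * (4 * (real n)\<^sup>2 - p\<^sup>2))"
    and im: "Im (A n / of_real (2 * real n - p) - cnj (A n) / of_real (2 * real n + p)) = 2 / pi * (ln (real n) / (4 * (real n)\<^sup>2 - p\<^sup>2))"
    if "n > 0" for n
  proof -
    have f: "4 * (real n)\<^sup>2 - p\<^sup>2 = (2 * real n - p) * (2 * real n + p)" by (simp add: power2_eq_square algebra_simps)
    have r: "Re (z / of_real t) = Re z / t" "Im (z / of_real t) = Im z / t" for z t
      by (rule Re_divide_of_real Im_divide_of_real)+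
    show "Re (A n / of_real (2 * real n - p) - cnj (A n) / of_real (2 * real n + p)) = p / (2 * real n * (4 * (real n)\<^sup>2 - p\<^sup>2))"
      unfolding f minus_complex.sel r using that nz(2,3)[of n] by (simp add: A_def divide_simps)
    show "Im (A n / of_real (2 * real n - p) - cnj (A n) / of_real (2 * real n + p)) = 2 / pi * (ln (real n) / (4 * (real n)\<^sup>2 - p\<^sup>2))"
      unfolding f minus_complex.sel r using that nz(2,3)[of n] by (simp add: A_def divide_simps) (simp add: algebra_simps)
  qed
  have A0: "- A 0 / of_real p = of_real (- (ln (2 * pi) / 2 + c / 2) / p)" by (simp add: A_def)
  have "(\<lambda>N. Im (fourier_pairing p A N)) \<longlonglongrightarrow> Im S"
    using lim unfolding S_def by (rule tendsto_Im)
  moreover have "Im (fourier_pairing p A N) = (\<Sum>n<N. 2 / pi * (ln (real (Suc n)) / (4 * (real (Suc n))\<^sup>2 - p\<^sup>2)))" for N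
    unfolding fourier_pairing_def A0 plus_complex.sel Im_sum
    by (simp add: im sum.atLeast1_atMost_eq del: of_nat_Suc of_real_diff of_real_add minus_complex.sel)
  ultimately have "(\<lambda>n. 2 / pi * (ln (real (Suc n)) / (4 * (real (Suc n))\<^sup>2 - p\<^sup>2))) sums Im S"
    by (simp add: sums_def)
  from sums_mult[OF this, of "pi / 2"]
  have T: "(\<lambda>n. ln (real (Suc n)) / (4 * (real (Suc n))\<^sup>2 - p\<^sup>2)) sums (pi / 2 * Im S)"
    by simp

  have "(\<lambda>N. Re (fourier_pairing p A N)) \<longlonglongrightarrow> Re S"
    using lim unfolding S_def by (rule tendsto_Re)
  moreover have "Re (fourier_pairing p A N) = - (ln (2 * pi) / 2 + c / 2) / p + (\<Sum>n<N. p / (2 * real (Suc n) * (4 * (real (Suc n))\<^sup>2 - p\<^sup>2)))" for N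
    unfolding fourier_pairing_def A0 plus_complex.sel Re_sum
    by (simp add: re sum.atLeast1_atMost_eq del: of_nat_Suc of_real_diff of_real_add minus_complex.sel)
  moreover have "(\<lambda>n. p / (2 * real (Suc n) * (4 * (real (Suc n))\<^sup>2 - p\<^sup>2))) sums
            (- 1 / (4 * p) * (Digamma (p / 2) + Digamma (- (p / 2)) + 2 * euler_mascheroni))"
  proof -
    have "p / 2 \<notin> \<int>"
    proof
      assume "p / 2 \<in> \<int>"
      then obtain k where "p / 2 = of_int k" by (elim Ints_cases)
      then have "p = 2 * of_int k" by simp
      with p show False by blast
    qed
    from sums_mult[OF Digamma_add_minus[OF this], of "- 1 / (4 * p)"]
    have "(\<lambda>n. - 1 / (4 * p) * (- 2 * (p / 2)\<^sup>2 / (real (Suc n) * ((real (Suc n))\<^sup>2 - (p / 2)\<^sup>2)))) sums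
            (- 1 / (4 * p) * (Digamma (p / 2) + Digamma (- (p / 2)) + 2 * euler_mascheroni))" .
    moreover have "- 1 / (4 * p) * (- 2 * (p / 2)\<^sup>2 / (m * (m\<^sup>2 - (p / 2)\<^sup>2))) = p / (2 * m * (4 * m\<^sup>2 - p\<^sup>2))" for m :: real
    proof -
      have "m\<^sup>2 - (p / 2)\<^sup>2 = (4 * m\<^sup>2 - p\<^sup>2) / 4" by (simp add: power_divide diff_divide_distrib)
      moreover have "- 1 / (4 * p) * (- 2 * (p / 2)\<^sup>2 / (m * (y / 4))) = p / (2 * m * y)" for y
        using nz(1) by (simp add: power2_eq_square)
      ultimately show ?thesis by (simp only:)
    qed
    ultimately show ?thesis by simp
  qed
  then have "(\<lambda>N. - (ln (2 * pi) / 2 + c / 2) / p + (\<Sum>n<N. p / (2 * real (Suc n) * (4 * (real (Suc n))\<^sup>2 - p\<^sup>2))))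
     \<longlonglongrightarrow> - (ln (2 * pi) / 2 + c / 2) / p + (- 1 / (4 * p) * (Digamma (p / 2) + Digamma (- (p / 2)) + 2 * euler_mascheroni))"
    by (intro tendsto_add tendsto_const) (simp add: sums_def)
  ultimately have ReS0: "Re S = - (ln (2 * pi) / 2 + c / 2) / p + (- 1 / (4 * p) * (Digamma (p / 2) + Digamma (- (p / 2)) + 2 * euler_mascheroni))"
    using LIMSEQ_unique by simp
  then have ReS: "Re S = - (c + (Digamma (p / 2) + Digamma (- p / 2)) / 4) / p"
  proof -
    have "- X / p + (- 1 / (4 * p) * Y) = - (X + Y / 4) / p" for X Y :: real
      using nz(1) by (simp add: field_simps)
    moreover have "ln (2 * pi) / 2 + c / 2 + (Digamma (p / 2) + Digamma (- (p / 2)) + 2 * euler_mascheroni) / 4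
        = c + (Digamma (p / 2) + Digamma (- p / 2)) / 4"
      by (simp add: c_def field_simps)
    ultimately show ?thesis using ReS0 by (simp only:)
  qed

  have i1: "((\<lambda>x. (ln (Gamma x) + c * x) * sin (p * pi * x)) has_integral Im J) {0<..<1}"
    using has_integral_linear[OF J bounded_linear_Im] by (simp add: o_def Im_exp Re_exp mult_ac)
  have pp: "p * pi \<noteq> 0" using nz(1) by simp
  have i2: "((\<lambda>x. x * sin (p * pi * x)) has_integral (- cos (p * pi) / (p * pi) + sin (p * pi) / (p * pi)\<^sup>2)) {0<..<1}"
  proof -
    have "Im (exp (\<i> * of_real (p * pi)) / (\<i> * of_real (p * pi)) + (exp (\<i> * of_real (p * pi)) - 1) / of_real (p * pi) ^ 2)
       = - cos (p * pi) / (p * pi) + sin (p * pi) / (p * pi)\<^sup>2"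
      using pp unfolding of_real_power[symmetric] plus_complex.sel Im_divide_of_real
      by (simp add: Im_divide Im_exp Re_exp power2_eq_square)
    with has_integral_linear[OF has_integral_times_exp[OF pp] bounded_linear_Im] show ?thesis
      by (simp add: o_def Im_exp Re_exp)
  qed
  have "((\<lambda>x. (ln (Gamma x) + c * x) * sin (p * pi * x) - c * (x * sin (p * pi * x))) has_integral
     (Im J - c * (- cos (p * pi) / (p * pi) + sin (p * pi) / (p * pi)\<^sup>2))) {0<..<1}"
    by (intro has_integral_diff i1 has_integral_mult_right i2)
  also have "Im J - c * (- cos (p * pi) / (p * pi) + sin (p * pi) / (p * pi)\<^sup>2) =
         (1 - cos (p * pi)) / (p * pi) * (c + (Digamma (p / 2) + Digamma (- p / 2)) / 4)
         + c * cos (p * pi) / (p * pi) - c * sin (p * pi) / (p * pi)\<^sup>2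
         - 2 * sin (p * pi) / pi\<^sup>2 * (pi / 2 * Im S)"
    unfolding ImJ ReS using nz(1) by (simp add: field_simps power2_eq_square)
  finally have "((\<lambda>x. ln (Gamma x) * sin (p * pi * x)) has_integral
         (1 - cos (p * pi)) / (p * pi) * (c + (Digamma (p / 2) + Digamma (- p / 2)) / 4)
         + c * cos (p * pi) / (p * pi) - c * sin (p * pi) / (p * pi)\<^sup>2
         - 2 * sin (p * pi) / pi\<^sup>2 * (pi / 2 * Im S)) {0..1}"
    unfolding has_integral_Icc_iff_Ioo by (rule has_integral_eq[rotated]) (simp add: algebra_simps)
  with T show ?thesis by blast
qed

text \<open>
  The closed interval may be replaced by the open one because the integrand is \<open>0\<close> at both end
  points: \<open>sin 0 = 0\<close> and \<open>ln (Gamma 1) = 0\<close>.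
\<close>
lemma set_integrable_ln_Gamma_sin:
  assumes "(\<lambda>x. ln (Gamma x) * sin (c * x)) integrable_on {0..1}"
  shows "set_integrable lborel {0..1} (\<lambda>x::real. ln (Gamma x) * sin (c * x))"
proof -
  let ?g = "\<lambda>x::real. ln (Gamma x) * sin (c * x)"
  have "?g absolutely_integrable_on {0<..<1}"
  proof (rule absolutely_integrable_integrable_bound)
    show "?g integrable_on {0<..<1}" using assms by (simp add: integrable_on_open_interval_real)
    show "(\<lambda>x::real. 1 - ln x) integrable_on {0<..<1}"
      by (intro integrable_diff integrable_ln) (simp add: integrable_on_open_interval_real integrable_const_ivl)
    fix x :: real assume x: "x \<in> {0<..<1}"
    have "\<bar>ln (Gamma x)\<bar> * \<bar>sin (c * x)\<bar> \<le> (1 - ln x) * 1"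
      using abs_ln_Gamma_le[of x] x by (intro mult_mono) auto
    then show "norm (?g x) \<le> 1 - ln x" by (simp add: abs_mult)
  qed
  moreover have "continuous_on {0<..<1} ?g"
    by (intro continuous_intros) (auto simp: nonpos_Ints_def Gamma_eq_zero_iff)
  then have "(\<lambda>x. indicator {0<..<1} x *\<^sub>R ?g x) \<in> borel_measurable lborel"
    using borel_measurable_continuous_on_indicator[of "{0<..<1}" ?g] by simp
  ultimately have "integrable lborel (\<lambda>x. indicator {0<..<1} x *\<^sub>R ?g x)"
    unfolding set_integrable_def by (simp only: integrable_completion)
  also have "(\<lambda>x. indicator {0<..<1} x *\<^sub>R ?g x) = (\<lambda>x. indicator {0..1} x *\<^sub>R ?g x)"
  proof
    fix x :: real
    show "indicator {0<..<1} x *\<^sub>R ?g x = indicator {0..1} x *\<^sub>R ?g x"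
      by (cases "x = 0 \<or> x = 1") (auto simp: indicator_def)
  qed
  finally show ?thesis unfolding set_integrable_def .
qed

theorem mainTheorem2:
  fixes p :: real
  assumes "\<not> (\<exists>k::int. p = 2 * of_int k)"
  shows "set_integrable lborel {0..1} (\<lambda>x::real. ln (Gamma x) * sin (p * pi * x))
    \<and> summable (\<lambda>n::nat. ln (real (Suc n)) / (4 * (real (Suc n))\<^sup>2 - p\<^sup>2))
    \<and> (LINT x:{0..1}|lborel. ln (Gamma x) * sin (p * pi * x)) =
        (1 - cos (p * pi)) * (euler_mascheroni + ln (2 * pi)) / (2 * p * pi)
        + (1 - cos (p * pi)) / (4 * p * pi) * (Digamma (p / 2) + Digamma (- p / 2))
        - 2 * sin (p * pi) * (euler_mascheroni + ln (2 * pi)) / pi\<^sup>2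
            * (1 / (2 * p\<^sup>2) - pi / (4 * p) * cot (p * pi / 2))
        - 2 * sin (p * pi) / pi\<^sup>2
            * (\<Sum>n. ln (real (Suc n)) / (4 * (real (Suc n))\<^sup>2 - p\<^sup>2))"
proof -
  define c :: real where "c = euler_mascheroni + ln (2 * pi)"
  define D where "D = Digamma (p / 2) + Digamma (- p / 2)"
  obtain T where T: "(\<lambda>n. ln (real (Suc n)) / (4 * (real (Suc n))\<^sup>2 - p\<^sup>2)) sums T"
    and I: "((\<lambda>x. ln (Gamma x) * sin (p * pi * x)) has_integral
         (1 - cos (p * pi)) / (p * pi) * (c + D / 4)
         + c * cos (p * pi) / (p * pi) - c * sin (p * pi) / (p * pi)\<^sup>2
         - 2 * sin (p * pi) / pi\<^sup>2 * T) {0..1}"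
    using sine_integral_via_series[OF assms] unfolding c_def D_def by blast
  have int: "set_integrable lborel {0..1} (\<lambda>x::real. ln (Gamma x) * sin (p * pi * x))"
    using I by (intro set_integrable_ln_Gamma_sin has_integral_integrable)
  have p0: "p \<noteq> 0" using not_even_integer_nonzero[OF assms] by simp
  have s0: "sin (p * pi / 2) \<noteq> 0"
  proof
    assume "sin (p * pi / 2) = 0"
    then obtain k :: int where "p * pi / 2 = of_int k * pi" by (auto simp: sin_zero_iff_int2)
    then have "p = 2 * of_int k" by simp
    with assms show False by blast
  qed
  have sc: "sin (p * pi) * cot (p * pi / 2) = 1 + cos (p * pi)"
  proof -
    have "sin (p * pi) = 2 * sin (p * pi / 2) * cos (p * pi / 2)" "cos (p * pi) = 2 * (cos (p * pi / 2))\<^sup>2 - 1"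
      using sin_double[of "p * pi / 2"] cos_double_cos[of "p * pi / 2"] by simp_all
    then show ?thesis using s0 by (simp add: cot_def power2_eq_square)
  qed
  have "(LINT x:{0..1}|lborel. ln (Gamma x) * sin (p * pi * x)) =
         (1 - cos (p * pi)) / (p * pi) * (c + D / 4)
         + c * cos (p * pi) / (p * pi) - c * sin (p * pi) / (p * pi)\<^sup>2
         - 2 * sin (p * pi) / pi\<^sup>2 * T"
    using set_borel_integral_eq_integral(2)[OF int] integral_unique[OF I] by simp
  also have "\<dots> = (1 - cos (p * pi)) * c / (2 * p * pi) + (1 - cos (p * pi)) / (4 * p * pi) * D
        - (2 * c / pi\<^sup>2) * (sin (p * pi) / (2 * p\<^sup>2) - pi / (4 * p) * (1 + cos (p * pi)))
        - 2 * sin (p * pi) / pi\<^sup>2 * T"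
    using p0 by (simp add: field_simps power2_eq_square)
  also have "(2 * c / pi\<^sup>2) * (sin (p * pi) / (2 * p\<^sup>2) - pi / (4 * p) * (1 + cos (p * pi)))
      = 2 * sin (p * pi) * c / pi\<^sup>2 * (1 / (2 * p\<^sup>2) - pi / (4 * p) * cot (p * pi / 2))"
    unfolding sc[symmetric] by (simp add: algebra_simps)
  finally show ?thesis
    using int T unfolding c_def D_def sums_iff by simp
qed

end
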